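(* For any $p>2$ and any $\varepsilon\in(0,1)$ there exists a compact set $E\subset\mathbb{T}$ with $m(E)>1-\varepsilon$ which satisfies the following properties: (a) For any $f\in A_p(\mathbb{T})$ and any continuous function $g$ on $\mathbb{T}$, there exist trigonometric polynomials $\{T_N\}_N$ with the properties that, as $N\to\infty$, $$\sum_{n\in\mathbb{Z}}|\widehat{T}_N(n)-\widehat{f}(n)|^p\to 0,\qquad \sup_E|T_N-g|\to 0.$$ (b) Whenever $\{Q_N\}_N$ are analytic polynomials which satisfy, as $N\to\infty$, $$\sum_{n\in\mathbb{Z}}|\widehat{Q}_N(n)-\widehat{f}(n)|^p\to 0,\qquad \sup_E|Q_N|\to 0,$$ for some $f\in H^2$, then $f$ is identically zero.
   Context: $\mathbb{T}\cong[0,1)$ is the unit circle and $m$ is the Lebesgue measure on $\mathbb{T}$ normalized so that $m(\mathbb{T})=1$; Fourier coefficients of functions are $\widehat{f}(n)=\int_{\mathbb{T}}f(\zeta)\zeta^{-n}\,dm(\zeta)$. $A_p(\mathbb{T})$ is the space of distributions on $\mathbb{T}$ whose Fourier coefficients lie in $\ell^p(\mathbb{Z})$. Analytic polynomials are finite linear combinations of $\zeta^n$, $n\ge0$; trigonometric polynomials are finite linear combinations of $\zeta^n$, $n\in\mathbb{Z}$. $H^2$ is the Hardy space, identified with the closed subspace of $L^2(\mathbb{T},dm)$ of functions with $\widehat{f}(n)=0$ for $n<0$. *)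

theory Defs
  imports "HOL-Analysis.Analysis"
begin

text \<open>
  The circle is the subset \<open>sphere 0 1\<close> of the complex plane, parametrised by
  \<open>t \<mapsto> cis (2 * pi * t)\<close> for \<open>t\<close> in \<open>[0, 1)\<close>. Functions on it are functions
  \<open>complex \<Rightarrow> complex\<close>; no notion below depends on their values off the circle.
\<close>

abbreviation circle :: "complex set"
  where "circle \<equiv> sphere 0 1"

definition circle_measure :: "complex measure"
  where "circle_measure =
    distr (restrict_space lborel {0..<1::real}) (restrict_space borel circle)
      (\<lambda>t. cis (2 * pi * t))"

definition fourier_coeff :: "(complex \<Rightarrow> complex) \<Rightarrow> int \<Rightarrow> complex"
  where "fourier_coeff f n = (LINT z|circle_measure. f z * z powi (- n))"

definition trig_polynomial :: "(complex \<Rightarrow> complex) \<Rightarrow> bool"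
  where "trig_polynomial T \<longleftrightarrow>
    (\<exists>S c. finite (S :: int set) \<and> (\<forall>z\<in>circle. T z = (\<Sum>n\<in>S. c n * z powi n)))"

definition analytic_polynomial :: "(complex \<Rightarrow> complex) \<Rightarrow> bool"
  where "analytic_polynomial Q \<longleftrightarrow>
    (\<exists>S c. finite (S :: nat set) \<and> (\<forall>z\<in>circle. Q z = (\<Sum>n\<in>S. c n * z ^ n)))"

text \<open>
  Elements of \<open>H\<^sup>2\<close> are represented by Borel functions (every class in \<open>L\<^sup>2\<close> has a
  Borel representative), so equality in \<open>H\<^sup>2\<close> is equality almost everywhere.
\<close>

definition H2 :: "(complex \<Rightarrow> complex) set"
  where "H2 = {f. f \<in> borel_measurable circle_measure \<and>
    integrable circle_measure (\<lambda>z. (norm (f z))\<^sup>2) \<and>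
    (\<forall>n<0. fourier_coeff f n = 0)}"

text \<open>
  Distributions on the circle: linear functionals on the smooth functions that are
  continuous for the topology given by the suprema of the derivatives with respect to
  the parameter \<open>t\<close>. The bound forces such a functional to ignore the values of a test
  function off the circle. Its values at functions that are not smooth play no role.
\<close>

definition circle_deriv :: "nat \<Rightarrow> (complex \<Rightarrow> complex) \<Rightarrow> real \<Rightarrow> complex"
  where "circle_deriv k \<phi> =
    ((\<lambda>h t. vector_derivative h (at t)) ^^ k) (\<lambda>t. \<phi> (cis (2 * pi * t)))"

definition circle_smooth :: "(complex \<Rightarrow> complex) \<Rightarrow> bool"
  where "circle_smooth \<phi> \<longleftrightarrow> (\<forall>k t. circle_deriv k \<phi> differentiable (at t))"

definition circle_distribution :: "((complex \<Rightarrow> complex) \<Rightarrow> complex) \<Rightarrow> bool"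
  where "circle_distribution u \<longleftrightarrow>
    (\<forall>\<phi> \<psi>. circle_smooth \<phi> \<longrightarrow> circle_smooth \<psi> \<longrightarrow> u (\<lambda>z. \<phi> z + \<psi> z) = u \<phi> + u \<psi>) \<and>
    (\<forall>a \<phi>. circle_smooth \<phi> \<longrightarrow> u (\<lambda>z. a * \<phi> z) = a * u \<phi>) \<and>
    (\<exists>C k. \<forall>\<phi>. circle_smooth \<phi> \<longrightarrow>
      norm (u \<phi>) \<le> C * (\<Sum>j\<le>k. SUP t\<in>{0..1}. norm (circle_deriv j \<phi> t)))"

definition distribution_coeff :: "((complex \<Rightarrow> complex) \<Rightarrow> complex) \<Rightarrow> int \<Rightarrow> complex"
  where "distribution_coeff u n = u (\<lambda>z. z powi (- n))"

definition A_space :: "real \<Rightarrow> ((complex \<Rightarrow> complex) \<Rightarrow> complex) set"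
  where "A_space p = {u. circle_distribution u \<and>
    (\<lambda>n. norm (distribution_coeff u n) powr p) summable_on UNIV}"

text \<open>
  The \<open>p\<close>-th power of the \<open>\<ell>\<^sup>p\<close> distance, taken in the extended reals so that a
  divergent sum is \<open>\<infinity>\<close> and not the default value 0 of a real infinite sum.
\<close>

definition lp_dist_powr :: "real \<Rightarrow> (int \<Rightarrow> complex) \<Rightarrow> (int \<Rightarrow> complex) \<Rightarrow> ennreal"
  where "lp_dist_powr p a b = (\<Sum>\<^sub>\<infinity>n\<in>UNIV. ennreal (norm (a n - b n) powr p))"

end

theory Submission
  imports Defs "HOL-Complex_Analysis.Conformal_Mappings" "HOL-Real_Asymp.Real_Asymp"
    "HOL-Computational_Algebra.Polynomial"
begin

text \<open>
  The set \<open>E\<close> is the circle with countably many families of small arcs removed. The arcs are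
  the sets where \<open>Re (z ^ N)\<close> exceeds \<open>1 - d\<^sup>2 / 2\<close>, that is, the preimages under \<open>z \<mapsto> z ^ N\<close> of
  an arc of length about \<open>2 * d\<close> around \<open>1\<close>; they come in stages, and a stage uses one \<open>d\<close> and
  \<open>K\<close> consecutive exponents \<open>N\<close>.

  A stage makes a trigonometric polynomial \<open>T\<close> that is almost \<open>1\<close> on \<open>E\<close> and has small
  \<open>\<ell>\<^sup>p\<close> norm of coefficients. Let \<open>b\<close> be a normalised power of \<open>1 + Re w\<close>, with degree \<open>n\<close> and mean
  \<open>1\<close>, which is concentrated on the arc. Then \<open>1 - b (z ^ N)\<close> has mean \<open>0\<close>, is almost \<open>1\<close> off the arcs,
  and the \<open>p\<close>-th powers of its coefficients add up to at most about \<open>sqrt n\<close>, where \<open>sqrt n\<close> is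
  roughly \<open>1 / d\<close>. The average of these functions over the \<open>K\<close> exponents is still almost \<open>1\<close> off
  all arcs; the spectra are disjoint, so the sum of \<open>p\<close>-th powers becomes \<open>K powr (1 - p) / d\<close>.
  The arcs removed have total measure about \<open>K * d\<close>. Both quantities can be small exactly because
  \<open>p > 2\<close> (\<open>parameters_exist\<close>, \<open>stage_exists\<close>). Given \<open>f\<close> and \<open>g\<close>, truncate \<open>f\<close> to a trigonometric
  polynomial \<open>s\<close>, approximate \<open>g\<close> uniformly by \<open>h\<close>, and take \<open>s + (h - s) * T\<close>: on \<open>E\<close> it is almost
  \<open>h\<close>, while its coefficients are almost those of \<open>s\<close> (\<open>simultaneous_approximation\<close>).

  For the uniqueness half, let \<open>Q\<close> be an analytic polynomial with coefficients bounded by \<open>C\<close>, so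
  that \<open>norm (Q z) \<le> C / (1 - norm z)\<close> in the disc, and let \<open>norm Q \<le> \<eta>\<close> on \<open>E\<close>. Remove from the
  disc the circular segments that the preimages of the chord \<open>Re w = 1 - d\<^sup>2 / 2\<close> cut off. The
  boundary of the remaining domain consists of a part of the circle on which \<open>Q\<close> is small and of
  pieces of preimages of chords. On the chords \<open>Q\<close> may be as large as \<open>C / (1 - norm z)\<close>, which is
  compensated by a multiplier \<open>G\<close> with \<open>norm G \<le> 1\<close> and \<open>norm G \<le> \<eta> * (1 - norm z)\<close> on the chords.
  Such a \<open>G\<close> is an explicit product over the pairs \<open>(N, d)\<close>, and \<open>norm (G 0)\<close> is at least a constant
  times \<open>sqrt \<eta>\<close>, provided that the sum of \<open>d * ln (2 * N / d\<^sup>2)\<close> over these pairs is small; this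
  is the logarithmic condition of Beurling and Carleson on the removed arcs. The maximum principle
  gives \<open>norm (Q 0) = O(sqrt \<eta>)\<close> (\<open>constant_coefficient_bound\<close>). Applied to \<open>Q\<close>,
  \<open>(Q - Q 0) / z\<close>, and so on, it shows that every coefficient of \<open>Q\<^sub>N\<close> tends to \<open>0\<close>
  (\<open>coefficients_tendsto_0\<close>), hence all Fourier coefficients of \<open>f\<close> vanish, and \<open>f = 0\<close> almost
  everywhere (\<open>fourier_coeff_unique\<close>).

  Since \<open>d\<close> and \<open>N\<close> are powers of \<open>K\<close> up to constants, the logarithm does not disturb the choice of
  parameters: a single cost per arc family controls both the measure of the removed arcs and the
  barrier.
\<close>

section \<open>Fourier coefficients on the circle\<close>

lemma circle_parametrisation_measurable:
  "(\<lambda>t. cis (2 * pi * t)) \<in> restrict_space lborel {0..<1} \<rightarrow>\<^sub>M restrict_space borel circle"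
proof (rule measurable_restrict_space2)
  show "(\<lambda>t. cis (2 * pi * t)) \<in> restrict_space lborel {0..<1} \<rightarrow>\<^sub>M borel"
    by (intro measurable_restrict_space1)
      (simp, intro borel_measurable_continuous_onI continuous_intros)
qed auto

lemma sets_circle_measure [measurable_cong]: "sets circle_measure = sets (restrict_space borel circle)"
  and space_circle_measure: "space circle_measure = circle"
  by (simp_all add: circle_measure_def space_restrict_space)

lemma emeasure_circle: "emeasure circle_measure circle = 1"
proof -
  have "emeasure circle_measure circle = emeasure (restrict_space lborel {0..<1::real}) {0..<1}"
    unfolding circle_measure_def
    by (subst emeasure_distr[OF circle_parametrisation_measurable])
      (auto simp: space_restrict_space sets_restrict_space intro!: arg_cong2[where f = emeasure])
  then show ?thesis by (simp add: emeasure_restrict_space)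
qed

lemma measure_circle: "measure circle_measure circle = 1"
  by (simp add: measure_def emeasure_circle)

interpretation circle: finite_measure circle_measure
  by (rule finite_measureI) (simp add: space_circle_measure emeasure_circle)

lemma borel_measurable_circle:
  assumes "continuous_on circle (f :: complex \<Rightarrow> 'a :: {topological_space})"
  shows "f \<in> borel_measurable circle_measure"
  using borel_measurable_continuous_on_restrict[OF assms] sets_circle_measure
  by (simp cong: measurable_cong_sets)

lemma integrable_circle:
  fixes f :: "complex \<Rightarrow> 'a :: {second_countable_topology, banach}"
  assumes "continuous_on circle f"
  shows "integrable circle_measure f"
proof -
  have "compact (f ` circle)" by (intro compact_continuous_image assms compact_sphere)
  then obtain B where "\<And>z. z \<in> circle \<Longrightarrow> norm (f z) \<le> B"
    using compact_imp_bounded bounded_iff by (metis image_eqI)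
  then show ?thesis
    by (intro circle.integrable_const_bound[of _ B] borel_measurable_circle assms AE_I2)
      (simp add: space_circle_measure)
qed

lemma continuous_on_circle_powi: "continuous_on circle (\<lambda>z :: complex. z powi k)"
  by (intro continuous_intros) auto

lemma integral_circle_powi: "(LINT z|circle_measure. z powi k) = (if k = 0 then 1 else 0)"
proof (cases "k = 0")
  case True
  then show ?thesis by (simp add: space_circle_measure measure_circle)
next
  case False
  define F where "F = (\<lambda>t. cis (2 * pi * t * k) / (2 * pi * \<i> * k))"
  have "(LINT z|circle_measure. z powi k) = (LINT t|restrict_space lborel {0..<1}. cis (2 * pi * t) powi k)"
    unfolding circle_measure_def
    by (intro integral_distr circle_parametrisation_measurable
        borel_measurable_continuous_on_restrict continuous_on_circle_powi)
  also have "\<dots> = (LINT t|lborel. indicator {0..<1} t *\<^sub>R cis (2 * pi * t * k))"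
    by (simp add: integral_restrict_space cis_power_int mult.commute mult.left_commute)
  also have "\<dots> = (LINT t|lborel. indicator {0..1} t *\<^sub>R cis (2 * pi * t * k))"
  proof (rule integral_cong_AE)
    show "AE t in lborel. indicat_real {0..<1} t *\<^sub>R cis (2 * pi * t * k) =
        indicat_real {0..1} t *\<^sub>R cis (2 * pi * t * k)"
      using AE_lborel_singleton[of "1::real"] by eventually_elim (auto simp: indicator_def)
    have "(\<lambda>t. cis (2 * pi * t * k)) \<in> borel_measurable lborel"
      by (simp, intro borel_measurable_continuous_onI continuous_intros)
    then show "(\<lambda>t. indicat_real {0..<1} t *\<^sub>R cis (2 * pi * t * k)) \<in> borel_measurable lborel"
      "(\<lambda>t. indicat_real {0..1} t *\<^sub>R cis (2 * pi * t * k)) \<in> borel_measurable lborel"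
      by (auto intro!: borel_measurable_scaleR)
  qed
  also have "\<dots> = F 1 - F 0"
  proof (rule integral_FTC_Icc)
    show "(F has_vector_derivative cis (2 * pi * t * k)) (at t within {0..1})" for t
    proof -
      have "((\<lambda>z. exp (2 * pi * \<i> * k * z) / (2 * pi * \<i> * k)) has_field_derivative exp (2 * pi * \<i> * k * t)) (at (of_real t))"
        using False by (auto intro!: derivative_eq_intros)
      from has_vector_derivative_real_field[OF this, of "{0..1}"] show ?thesis
        by (simp add: F_def cis_conv_exp mult_ac)
    qed
  qed (auto intro!: continuous_intros)
  also have "F 1 = F 0" 
    using cis_multiple_2pi[of "real_of_int k"] by (simp add: F_def)
  finally show ?thesis using False by simp
qed

lemma fourier_coeff_cong:
  "(\<And>z. z \<in> circle \<Longrightarrow> f z = g z) \<Longrightarrow> fourier_coeff f n = fourier_coeff g n"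
  unfolding fourier_coeff_def by (intro Bochner_Integration.integral_cong) (auto simp: space_circle_measure)

lemma fourier_coeff_sum_powi:
  assumes "finite S"
  shows "fourier_coeff (\<lambda>z. \<Sum>k\<in>S. c k * z powi k) n = (if n \<in> S then c n else 0)"
proof -
  have "fourier_coeff (\<lambda>z. \<Sum>k\<in>S. c k * z powi k) n =
      (LINT z|circle_measure. (\<Sum>k\<in>S. c k * z powi (k - n)))"
    unfolding fourier_coeff_def
  proof (intro Bochner_Integration.integral_cong refl)
    fix z assume "z \<in> space circle_measure"
    then have "z \<noteq> 0" by (auto simp: space_circle_measure)
    then have "z powi k * z powi (- n) = z powi (k - n)" for k
      by (simp add: power_int_add[symmetric])
    then show "(\<Sum>k\<in>S. c k * z powi k) * z powi (- n) = (\<Sum>k\<in>S. c k * z powi (k - n))"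
      by (simp add: sum_distrib_right mult.assoc)
  qed
  also have "\<dots> = (\<Sum>k\<in>S. c k * (LINT z|circle_measure. z powi (k - n)))"
    by (subst Bochner_Integration.integral_sum)
      (auto intro!: integrable_circle continuous_intros continuous_on_circle_powi)
  also have "\<dots> = (\<Sum>k\<in>S. if k = n then c k else 0)"
    by (intro sum.cong) (auto simp: integral_circle_powi)
  finally show ?thesis using assms by simp
qed

lemma fourier_coeff_add:
  assumes "continuous_on circle f" "continuous_on circle g"
  shows "fourier_coeff (\<lambda>z. f z + g z) n = fourier_coeff f n + fourier_coeff g n"
  unfolding fourier_coeff_def
  by (subst Bochner_Integration.integral_add[symmetric])
    (auto simp: distrib_right intro!: integrable_circle continuous_intros assms continuous_on_circle_powi)

text \<open>
  Only one factor has to be a trigonometric polynomial; the coefficients of the product are a finite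
  convolution.
\<close>

lemma fourier_coeff_sum_powi_mult:
  assumes "finite S" "continuous_on circle f"
  shows "fourier_coeff (\<lambda>z. (\<Sum>k\<in>S. c k * z powi k) * f z) n = (\<Sum>k\<in>S. c k * fourier_coeff f (n - k))"
proof -
  have "fourier_coeff (\<lambda>z. (\<Sum>k\<in>S. c k * z powi k) * f z) n =
      (LINT z|circle_measure. (\<Sum>k\<in>S. c k * (f z * z powi (- (n - k)))))"
    unfolding fourier_coeff_def
  proof (intro Bochner_Integration.integral_cong refl)
    fix z assume "z \<in> space circle_measure"
    then have "z \<noteq> 0" by (auto simp: space_circle_measure)
    then have "z powi k * z powi (- n) = z powi (- (n - k))" for k
      by (simp add: power_int_add[symmetric])
    then have "c k * z powi k * f z * z powi (- n) = c k * (f z * z powi (- (n - k)))" for k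
      by (metis mult.assoc mult.commute)
    then show "(\<Sum>k\<in>S. c k * z powi k) * f z * z powi (- n) = (\<Sum>k\<in>S. c k * (f z * z powi (- (n - k))))"
      unfolding sum_distrib_right by (intro sum.cong refl)
  qed
  also have "\<dots> = (\<Sum>k\<in>S. c k * fourier_coeff f (n - k))"
    unfolding fourier_coeff_def
    by (subst Bochner_Integration.integral_sum)
      (auto intro!: integrable_circle continuous_intros continuous_on_circle_powi assms)
  finally show ?thesis .
qed

lemma trig_polynomial_const: "trig_polynomial (\<lambda>z. a)"
  unfolding trig_polynomial_def
  by (rule exI[of _ "{0}"], rule exI[of _ "\<lambda>_. a"]) simp

lemma trig_polynomial_powi: "trig_polynomial (\<lambda>z. z powi k)"
  unfolding trig_polynomial_def
  by (rule exI[of _ "{k}"], rule exI[of _ "\<lambda>_. 1"]) simp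

lemma trig_polynomial_add:
  assumes "trig_polynomial f" "trig_polynomial g"
  shows "trig_polynomial (\<lambda>z. f z + g z)"
proof -
  obtain S c where S: "finite S" "\<And>z. z \<in> circle \<Longrightarrow> f z = (\<Sum>n\<in>S. c n * z powi n)"
    using assms(1) unfolding trig_polynomial_def by blast
  obtain T d where T: "finite T" "\<And>z. z \<in> circle \<Longrightarrow> g z = (\<Sum>n\<in>T. d n * z powi n)"
    using assms(2) unfolding trig_polynomial_def by blast
  define e where "e n = (if n \<in> S then c n else 0) + (if n \<in> T then d n else 0)" for n
  have "f z + g z = (\<Sum>n\<in>S \<union> T. e n * z powi n)" if "z \<in> circle" for z
  proof -
    have "f z = (\<Sum>n\<in>S \<union> T. (if n \<in> S then c n else 0) * z powi n)"
      unfolding S(2)[OF that] using S(1) T(1) by (intro sum.mono_neutral_cong_left) auto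
    moreover have "g z = (\<Sum>n\<in>S \<union> T. (if n \<in> T then d n else 0) * z powi n)"
      unfolding T(2)[OF that] using S(1) T(1) by (intro sum.mono_neutral_cong_left) auto
    ultimately show ?thesis by (simp add: e_def distrib_right sum.distrib)
  qed
  then show ?thesis unfolding trig_polynomial_def using S(1) T(1) by (meson finite_UnI)
qed

lemma trig_polynomial_sum:
  assumes "\<And>i. i \<in> I \<Longrightarrow> trig_polynomial (f i)"
  shows "trig_polynomial (\<lambda>z. \<Sum>i\<in>I. f i z)"
  using assms
  by (induction I rule: infinite_finite_induct) (auto intro: trig_polynomial_add trig_polynomial_const)

lemma trig_polynomial_cong:
  assumes "\<And>z. z \<in> circle \<Longrightarrow> f z = g z"
  shows "trig_polynomial f \<longleftrightarrow> trig_polynomial g"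
proof -
  have "(\<forall>z\<in>circle. f z = h z) \<longleftrightarrow> (\<forall>z\<in>circle. g z = h z)" for h
    using assms by auto
  then show ?thesis unfolding trig_polynomial_def by presburger
qed

lemma trig_polynomial_mult:
  assumes "trig_polynomial f" "trig_polynomial g"
  shows "trig_polynomial (\<lambda>z. f z * g z)"
proof -
  obtain S c where S: "\<And>z. z \<in> circle \<Longrightarrow> f z = (\<Sum>n\<in>S. c n * z powi n)"
    using assms(1) unfolding trig_polynomial_def by blast
  obtain T d where T: "\<And>z. z \<in> circle \<Longrightarrow> g z = (\<Sum>n\<in>T. d n * z powi n)"
    using assms(2) unfolding trig_polynomial_def by blast
  have "trig_polynomial (\<lambda>z. a * z powi k)" for a k
    unfolding trig_polynomial_def
    by (rule exI[of _ "{k}"], rule exI[of _ "\<lambda>_. a"]) simp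
  then have tp: "trig_polynomial (\<lambda>z. \<Sum>n\<in>S. \<Sum>m\<in>T. (c n * d m) * z powi (n + m))"
    by (intro trig_polynomial_sum)
  have eq: "f z * g z = (\<Sum>n\<in>S. \<Sum>m\<in>T. (c n * d m) * z powi (n + m))" if "z \<in> circle" for z
  proof -
    have "z \<noteq> 0" using that by auto
    then show ?thesis
      by (simp add: S[OF that] T[OF that] sum_product power_int_add mult.assoc mult.left_commute)
  qed
  show ?thesis
    by (rule trig_polynomial_cong[where f = "\<lambda>z. f z * g z", THEN iffD2, OF _ tp]) (rule eq)
qed

lemma continuous_on_trig_polynomial:
  assumes "trig_polynomial f"
  shows "continuous_on circle f"
proof -
  obtain S c where S: "\<And>z. z \<in> circle \<Longrightarrow> f z = (\<Sum>n\<in>S. c n * z powi n)"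
    using assms unfolding trig_polynomial_def by blast
  have "continuous_on circle (\<lambda>z. \<Sum>n\<in>S. c n * z powi n)"
    by (intro continuous_intros continuous_on_circle_powi)
  then show ?thesis by (rule continuous_on_eq) (rule S[symmetric])
qed

text \<open>
  On the circle \<open>cnj z = z powi (- 1)\<close>, so a real-linear function is a combination of \<open>z\<close> and
  \<open>z powi (- 1)\<close>; sums and products are harmless.
\<close>

lemma trig_polynomial_real_polynomial_function:
  assumes "real_polynomial_function (h :: complex \<Rightarrow> real)"
  shows "trig_polynomial (\<lambda>z. complex_of_real (h z))"
  using assms
proof induction
  case (linear h)
  have eq: "complex_of_real (h z) = (h 1 / 2 - \<i> * (h \<i> / 2)) * z powi 1 + (h 1 / 2 + \<i> * (h \<i> / 2)) * z powi (-1)"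
    if "z \<in> circle" for z
  proof -
    have "z = Re z *\<^sub>R 1 + Im z *\<^sub>R \<i>" by (simp add: complex_eq_iff)
    moreover have "h (Re z *\<^sub>R 1 + Im z *\<^sub>R \<i>) = Re z * h 1 + Im z * h \<i>"
      using bounded_linear.linear[OF linear] by (simp only: linear_add linear_scale real_scaleR_def)
    ultimately have "h z = Re z * h 1 + Im z * h \<i>" by simp
    moreover have "z * cnj z = 1" using that by (simp add: complex_norm_square[symmetric])
    then have "z powi (-1) = cnj z"
      by (simp add: power_int_minus inverse_unique)
    ultimately show ?thesis
      by (simp only: power_int_1_right) (simp add: complex_eq_iff field_simps)
  qed
  have tp: "trig_polynomial (\<lambda>z. (h 1 / 2 - \<i> * (h \<i> / 2)) * z powi 1 + (h 1 / 2 + \<i> * (h \<i> / 2)) * z powi (-1))"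
    by (intro trig_polynomial_add trig_polynomial_mult trig_polynomial_const trig_polynomial_powi)
  show ?case
    by (rule trig_polynomial_cong[where f = "\<lambda>z. complex_of_real (h z)", THEN iffD2, OF _ tp]) (rule eq)
qed (auto intro: trig_polynomial_const trig_polynomial_add trig_polynomial_mult)

text \<open>
  The Stone-Weierstrass theorem for polynomials in the real coordinates, restricted to the circle.
\<close>

theorem trig_polynomials_dense:
  assumes "continuous_on circle (g :: complex \<Rightarrow> complex)" "0 < e"
  obtains h where "trig_polynomial h" "\<And>z. z \<in> circle \<Longrightarrow> norm (g z - h z) < e"
proof -
  obtain h where h: "polynomial_function h" "\<forall>z\<in>circle. norm (g z - h z) < e"
    using Stone_Weierstrass_polynomial_function[OF compact_sphere assms] by blast
  have "real_polynomial_function (Re \<circ> h)" "real_polynomial_function (Im \<circ> h)"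
    using h(1) bounded_linear_Re bounded_linear_Im unfolding polynomial_function_def by blast+
  then have "trig_polynomial (\<lambda>z. of_real ((Re \<circ> h) z) + \<i> * of_real ((Im \<circ> h) z))"
    by (intro trig_polynomial_add trig_polynomial_mult trig_polynomial_const
        trig_polynomial_real_polynomial_function)
  then have "trig_polynomial h" by (simp flip: complex_eq)
  then show ?thesis using h(2) that by blast
qed

text \<open>
  If all coefficients vanish, then \<open>f\<close> integrates to \<open>0\<close> against trigonometric polynomials, hence by
  density against continuous functions, hence by dominated convergence over closed sets. Closed sets
  generate the Borel sets and are stable under intersections, so the integral of \<open>f\<close> over every
  Borel set is \<open>0\<close>.
\<close>

theorem fourier_coeff_unique:
  assumes f: "integrable circle_measure f" and zero: "\<And>n. fourier_coeff f n = 0"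
  shows "AE z in circle_measure. f z = 0"
proof (rule circle.density_zero[OF f])
  have int_mult: "integrable circle_measure (\<lambda>z. f z * g z)" if "continuous_on circle g" for g
  proof -
    have "compact (g ` circle)" by (intro compact_continuous_image that compact_sphere)
    then obtain B where B: "\<And>z. z \<in> circle \<Longrightarrow> norm (g z) \<le> B"
      using compact_imp_bounded bounded_iff by (metis image_eqI)
    show ?thesis
    proof (rule Bochner_Integration.integrable_bound)
      show "integrable circle_measure (\<lambda>z. norm (f z) * B)"
        using f by (intro integrable_mult_left integrable_norm) auto
      show "(\<lambda>z. f z * g z) \<in> borel_measurable circle_measure"
        using f borel_measurable_circle[OF that] by (intro borel_measurable_times) auto
      show "AE z in circle_measure. norm (f z * g z) \<le> norm (norm (f z) * B)"
      proof (rule AE_I2)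
        fix z assume "z \<in> space circle_measure"
        then have "norm (f z) * norm (g z) \<le> norm (f z) * B"
          by (intro mult_left_mono B) (auto simp: space_circle_measure)
        then show "norm (f z * g z) \<le> norm (norm (f z) * B)" by (simp add: norm_mult)
      qed
    qed
  qed
  have trig: "(LINT z|circle_measure. f z * h z) = 0" if h: "trig_polynomial h" for h
  proof -
    obtain S c where S: "\<And>z. z \<in> circle \<Longrightarrow> h z = (\<Sum>n\<in>S. c n * z powi n)"
      using h unfolding trig_polynomial_def by blast
    have "(LINT z|circle_measure. f z * h z) = (LINT z|circle_measure. (\<Sum>n\<in>S. c n * (f z * z powi n)))"
      by (intro Bochner_Integration.integral_cong)
        (auto simp: space_circle_measure S sum_distrib_left mult.left_commute)
    also have "\<dots> = (\<Sum>n\<in>S. c n * (LINT z|circle_measure. f z * z powi n))"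
      by (subst Bochner_Integration.integral_sum)
        (auto intro!: int_mult continuous_on_circle_powi)
    also have "\<dots> = 0"
    proof (intro sum.neutral ballI)
      show "c n * (LINT z|circle_measure. f z * z powi n) = 0" for n
        using zero[of "- n"] by (simp add: fourier_coeff_def)
    qed
    finally show ?thesis .
  qed
  have cont: "(LINT z|circle_measure. f z * g z) = 0" if g: "continuous_on circle g" for g
  proof -
    define I where "I = (LINT z|circle_measure. norm (f z))"
    have I0: "0 \<le> I" by (simp add: I_def)
    have "norm (LINT z|circle_measure. f z * g z) \<le> 0 + e" if "e > 0" for e
    proof -
      have "e / (I + 1) > 0" using that I0 by simp
      then obtain h where h: "trig_polynomial h" "\<And>z. z \<in> circle \<Longrightarrow> norm (g z - h z) < e / (I + 1)"
        using trig_polynomials_dense[OF g] by metis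
      note ch = continuous_on_trig_polynomial[OF h(1)]
      have "(LINT z|circle_measure. f z * g z) = (LINT z|circle_measure. f z * g z) - (LINT z|circle_measure. f z * h z)"
        using trig[OF h(1)] by simp
      also have "\<dots> = (LINT z|circle_measure. f z * (g z - h z))"
        by (subst Bochner_Integration.integral_diff[symmetric])
          (auto intro!: int_mult g ch simp: right_diff_distrib)
      finally have "norm (LINT z|circle_measure. f z * g z) = norm (LINT z|circle_measure. f z * (g z - h z))" by simp
      also have "\<dots> \<le> (LINT z|circle_measure. norm (f z * (g z - h z)))" by simp
      also have "\<dots> \<le> (LINT z|circle_measure. norm (f z) * (e / (I + 1)))"
        using h(2) by (intro integral_mono integrable_norm int_mult integrable_mult_left f continuous_intros g ch)
          (auto simp: norm_mult space_circle_measure simp del: times_divide_eq_right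
            intro!: mult_left_mono intro: less_imp_le)
      also have "\<dots> = I * (e / (I + 1))" by (simp add: I_def)
      also have "\<dots> \<le> e" using I0 that by (simp add: field_simps)
      finally show ?thesis by simp
    qed
    then show ?thesis using field_le_epsilon[of _ "0::real"] by (metis norm_le_zero_iff)
  qed
  define G where "G = {circle \<inter> C |C. closed C}"
  have sets: "sets circle_measure = sigma_sets circle G"
  proof -
    have "sets (restrict_space borel circle) = (\<inter>) circle ` sigma_sets UNIV (Collect closed)"
      unfolding sets_restrict_space borel_eq_closed by simp
    also have "\<dots> = sigma_sets circle G" 
      using sigma_sets_Int[of circle "UNIV" "Collect closed"]
      by (simp add: G_def setcompr_eq_image)
    finally show ?thesis by (simp add: sets_circle_measure)
  qed
  have set_int: "set_integrable circle_measure A f" if "A \<in> sets circle_measure" for A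
    using f that unfolding set_integrable_def by (intro integrable_mult_indicator)
  fix A assume "A \<in> sets circle_measure"
  then have A: "A \<in> sigma_sets circle G" by (simp add: sets)
  have "Int_stable G"
  proof (rule Int_stableI)
    fix a b assume "a \<in> G" "b \<in> G"
    then obtain C D where "a = circle \<inter> C" "closed C" "b = circle \<inter> D" "closed D"
      by (auto simp: G_def)
    then have "a \<inter> b = circle \<inter> (C \<inter> D)" "closed (C \<inter> D)" by auto
    then show "a \<inter> b \<in> G" unfolding G_def by blast
  qed
  moreover have "G \<subseteq> Pow circle" by (auto simp: G_def)
  ultimately show "set_lebesgue_integral circle_measure A f = 0"
    using A
  proof (induction A rule: sigma_sets_induct_disjoint)
    case (basic A)
    then obtain C where C: "closed C" "A = circle \<inter> C" by (auto simp: G_def)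
    show ?case
    proof (cases "C = {}")
      case False
      \<comment> \<open>Continuous functions that decrease to the indicator of \<open>C\<close>.\<close>
      define g where "g n z = complex_of_real (max 0 (1 - real n * infdist z C))" for n z
      have g: "continuous_on circle (g n)" for n
        unfolding g_def by (intro continuous_intros)
      have lim: "(\<lambda>n. g n z) \<longlonglongrightarrow> indicator C z" for z
      proof (cases "z \<in> C")
        case True
        then show ?thesis by (simp add: g_def)
      next
        case zC: False
        then have pos: "infdist z C > 0"
          using C(1) False in_closed_iff_infdist_zero infdist_nonneg by (metis less_eq_real_def)
        obtain N :: nat where N: "real N * infdist z C > 1" using reals_Archimedean3[OF pos] by blast
        have "g n z = 0" if "n \<ge> N" for n
        proof -
          have "real N * infdist z C \<le> real n * infdist z C"
            using that pos by (intro mult_right_mono) auto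
          then show ?thesis using N by (simp add: g_def)
        qed
        then show ?thesis using zC by (auto intro!: tendsto_eventually eventually_sequentiallyI)
      qed
      have "(\<lambda>n. LINT z|circle_measure. f z * g n z) \<longlonglongrightarrow> (LINT z|circle_measure. f z * indicator C z)"
      proof (rule integral_dominated_convergence)
        show "(\<lambda>z. f z * indicator C z) \<in> borel_measurable circle_measure"
        proof -
          have "(indicator C :: complex \<Rightarrow> complex) \<in> borel_measurable (restrict_space borel circle)"
            using C(1) by (intro measurable_restrict_space1 borel_measurable_indicator) auto
          then have "(indicator C :: complex \<Rightarrow> complex) \<in> borel_measurable circle_measure"
            by (simp add: measurable_cong_sets[OF sets_circle_measure refl])
          then show ?thesis using f by (intro borel_measurable_times) auto
        qed
        show "(\<lambda>z. f z * g n z) \<in> borel_measurable circle_measure" for n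
          using int_mult[OF g] by auto
        show "integrable circle_measure (\<lambda>z. norm (f z))" using f by simp
        show "AE z in circle_measure. (\<lambda>n. f z * g n z) \<longlonglongrightarrow> f z * indicator C z"
          by (intro AE_I2 tendsto_intros lim)
        have "norm (g n z) \<le> 1" for n z
          using infdist_nonneg[of z C] by (auto simp: g_def)
        then show "AE z in circle_measure. norm (f z * g n z) \<le> norm (f z)" for n
          by (intro AE_I2) (simp add: norm_mult mult_left_le)
      qed
      then have "(\<lambda>n :: nat. 0) \<longlonglongrightarrow> (LINT z|circle_measure. f z * indicator C z)"
        by (simp only: cont[OF g])
      then have "(LINT z|circle_measure. f z * indicator C z) = 0"
        by (simp only: LIMSEQ_const_iff)
      moreover have "set_lebesgue_integral circle_measure A f = (LINT z|circle_measure. f z * indicator C z)"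
        unfolding set_lebesgue_integral_def
        by (intro Bochner_Integration.integral_cong) (auto simp: C space_circle_measure indicator_def)
      ultimately show ?thesis by simp
    qed (simp add: C set_lebesgue_integral_def)
  next
    case (compl A)
    have all: "set_lebesgue_integral circle_measure circle f = 0"
      using zero[of 0] unfolding fourier_coeff_def set_lebesgue_integral_def
      by (subst (asm) Bochner_Integration.integral_cong[of _ _ _ "\<lambda>z. indicator circle z *\<^sub>R f z"])
        (auto simp: space_circle_measure)
    have A: "A \<in> sets circle_measure" "circle \<in> sets circle_measure"
      using compl sets.top[of circle_measure] by (auto simp: sets space_circle_measure)
    moreover have "A \<subseteq> circle" using sets.sets_into_space[OF A(1)] by (simp add: space_circle_measure)
    ultimately have "set_lebesgue_integral circle_measure (circle - A) f =
        set_lebesgue_integral circle_measure circle f - set_lebesgue_integral circle_measure A f"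
      using set_integral_Un[of A "circle - A" circle_measure f] set_int
      by (auto simp: Un_absorb1 Un_Diff_cancel)
    then show ?case using all compl by simp
  next
    case (union A)
    have "(\<Union>i. A i) \<in> sets circle_measure" using union by (auto simp: sets intro!: sigma_sets.Union)
    then have "(\<Sum>i. set_lebesgue_integral circle_measure (A i) f) =
        set_lebesgue_integral circle_measure (\<Union>i. A i) f"
      using union set_int
      by (intro lebesgue_integral_countable_add[symmetric]) (auto simp: sets disjoint_family_on_def)
    then show ?case using union by simp
  qed (simp add: set_lebesgue_integral_def)
qed

section \<open>A barrier for circular segments\<close>

text \<open>
  On the circle \<open>norm (w - 1) < d\<close> means \<open>Re w > cap_height d\<close>. The condition on the real part is
  used inside the disc as well, where it cuts off a circular segment.
\<close>

definition cap_height :: "real \<Rightarrow> real"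
  where "cap_height d = 1 - d\<^sup>2 / 2"

text \<open>
  The upper end point of the chord \<open>Re w = cap_height d\<close>; the lower one is its conjugate.
\<close>

definition cap_corner :: "real \<Rightarrow> complex"
  where "cap_corner d = Complex (cap_height d) (sqrt (1 - (cap_height d)\<^sup>2))"

text \<open>
  The two quotients vanish at the end points of the chord and offset the growth \<open>1 / (1 - norm w)\<close>
  there. The exponential is \<open>exp (- \<Lambda>)\<close> or less on the whole chord, since \<open>d / (1 + d - w)\<close> has
  positive real part in the disc and real part at least \<open>1 / 4\<close> within distance \<open>d\<close> of \<open>1\<close>; at the
  origin that function is only of size \<open>d\<close>.
\<close>

definition barrier :: "real \<Rightarrow> real \<Rightarrow> complex \<Rightarrow> complex"
  where "barrier d \<Lambda> w =
    (1 - w * cnj (cap_corner d)) / (1 + d - w * cnj (cap_corner d)) *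
    ((1 - w * cap_corner d) / (1 + d - w * cap_corner d)) *
    exp (- (4 * \<Lambda> * d / (1 + d - w)))"

lemma cap_height_bounds:
  assumes "0 < d" "d \<le> 1"
  shows "1/2 \<le> cap_height d" "cap_height d < 1" "(cap_height d)\<^sup>2 \<le> 1"
proof -
  have "d\<^sup>2 \<le> 1" using assms by (simp add: power_le_one)
  then show *: "1/2 \<le> cap_height d" "cap_height d < 1"
    using assms by (auto simp: cap_height_def)
  then show "(cap_height d)\<^sup>2 \<le> 1" by (simp add: power_le_one)
qed

lemma norm_cap_corner:
  assumes "0 < d" "d \<le> 1"
  shows "norm (cap_corner d) = 1"
  using cap_height_bounds[OF assms] by (simp add: cap_corner_def cmod_def)

lemma Re_shift_ge:
  assumes "norm w \<le> 1" "norm b = 1"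
    and "0 < d"
  shows "d \<le> Re (1 + of_real d - w * b)" "d \<le> norm (1 + of_real d - w * b)"
    and "norm (1 - w * b) \<le> norm (1 + of_real d - w * b)"
proof -
  have "norm (w * b) \<le> 1" using assms by (simp add: norm_mult)
  then have re: "Re (w * b) \<le> 1" using complex_Re_le_cmod order_trans by blast
  then show 1: "d \<le> Re (1 + of_real d - w * b)" by simp
  then show "d \<le> norm (1 + of_real d - w * b)"
    using complex_Re_le_cmod order_trans by blast
  have "(Re (1 - w * b))\<^sup>2 \<le> (Re (1 + of_real d - w * b))\<^sup>2"
    using re assms(3) by (intro power_mono) auto
  then show "norm (1 - w * b) \<le> norm (1 + of_real d - w * b)"
    by (simp add: cmod_def)
qed

lemma norm_exp_barrier_le_1:
  fixes w :: complex and d \<Lambda> :: real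
  assumes "norm w \<le> 1" "0 < d" "0 \<le> \<Lambda>"
  shows "norm (exp (- (4 * \<Lambda> * d / (1 + d - w)))) \<le> 1"
proof -
  have "0 \<le> Re (of_real (4 * \<Lambda> * d) * inverse (1 + d - w))"
    using Re_shift_ge(1)[of w 1 d] assms
    by (simp del: of_real_mult)
  then show ?thesis by (simp add: divide_inverse mult.assoc)
qed

lemma norm_barrier_le_1:
  assumes "norm w \<le> 1" "0 < d" "d \<le> 1" "0 \<le> \<Lambda>"
  shows "norm (barrier d \<Lambda> w) \<le> 1"
proof -
  let ?b = "cap_corner d"
  have b: "norm ?b = 1" "norm (cnj ?b) = 1" using norm_cap_corner assms by auto
  have "norm ((1 - w * c) / (1 + d - w * c)) \<le> 1" if "norm c = 1" for c
    using Re_shift_ge(2,3)[OF assms(1) that assms(2)] assms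
    by (auto simp: norm_divide divide_le_eq)
  then show ?thesis unfolding barrier_def norm_mult
    using b norm_exp_barrier_le_1[OF assms(1,2,4)] by (intro mult_le_one) (auto intro!: mult_le_one)
qed

text \<open>
  Let \<open>b\<close> be the upper end point. A point \<open>w\<close> of the chord divides it into segments of lengths
  \<open>norm (b - w)\<close> and \<open>norm (cnj b - w)\<close>, and the product of these lengths is
  \<open>1 - (norm w)\<^sup>2\<close>. Thus the zeros of the two quotients compensate a first order blow-up at the
  circle exactly, although the chord meets the circle at a small angle, about \<open>d\<close>.
\<close>

lemma norm_barrier_on_chord:
  assumes "norm w \<le> 1" "0 < d" "d \<le> 1" "0 \<le> \<Lambda>" and chord: "Re w = cap_height d"
  shows "norm (barrier d \<Lambda> w) \<le> (1 - (norm w)\<^sup>2) / d\<^sup>2 * exp (- \<Lambda>)"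
proof -
  define b where "b = cap_corner d"
  have b: "norm b = 1" "norm (cnj b) = 1" using norm_cap_corner assms b_def by auto
  have ex: "norm (exp (- (4 * \<Lambda> * d / (1 + d - w)))) \<le> exp (- \<Lambda>)"
  proof -
    let ?u = "1 + d - w"
    have "(norm w)\<^sup>2 \<le> 1" using assms(1) by (simp add: power_le_one)
    then have "(Im w)\<^sup>2 \<le> 1 - (cap_height d)\<^sup>2"
      using chord by (simp add: cmod_power2)
    then have "(norm ?u)\<^sup>2 \<le> 4 * d\<^sup>2"
    proof -
      have "(norm ?u)\<^sup>2 = (d + d\<^sup>2/2)\<^sup>2 + (Im w)\<^sup>2"
        using chord by (simp add: cmod_power2 cap_height_def)
      also have "\<dots> \<le> (d + d\<^sup>2/2)\<^sup>2 + 1 - (1 - d\<^sup>2/2)\<^sup>2"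
        using \<open>(Im w)\<^sup>2 \<le> _\<close> by (simp add: cap_height_def)
      also have "\<dots> = 2 * d\<^sup>2 + d * d\<^sup>2"
        by (simp add: power2_eq_square field_simps)
      also have "\<dots> \<le> 2 * d\<^sup>2 + 1 * d\<^sup>2"
        using assms by (intro add_left_mono mult_right_mono) auto
      also have "\<dots> \<le> 4 * d\<^sup>2" by simp
      finally show ?thesis .
    qed
    moreover have "d \<le> Re ?u" using Re_shift_ge(1)[of w 1 d] assms by simp
    ultimately have "d / (4 * d\<^sup>2) \<le> Re ?u / (norm ?u)\<^sup>2"
      using assms by (intro frac_le) (auto simp: intro: order_trans)
    then have "1 / (4 * d) \<le> Re (inverse ?u)"
      using assms(2) unfolding inverse_complex.simps cmod_power2[symmetric]
      by (simp add: power2_eq_square)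
    then have "4 * \<Lambda> * d * (1 / (4 * d)) \<le> 4 * \<Lambda> * d * Re (inverse ?u)"
      using assms by (intro mult_left_mono) auto
    then have "\<Lambda> \<le> 4 * \<Lambda> * d * Re (inverse ?u)"
      using assms(2) by simp
    also have "\<dots> = Re (of_real (4 * \<Lambda> * d) * inverse ?u)"
      by (simp del: of_real_mult)
    finally show ?thesis by (simp add: divide_inverse mult.assoc)
  qed
  have prod: "norm (1 - w * cnj b) * norm (1 - w * b) = 1 - (norm w)\<^sup>2"
  proof -
    define y where "y = Im w"
    define s where "s = sqrt (1 - (cap_height d)\<^sup>2)"
    have s2: "s\<^sup>2 = 1 - (cap_height d)\<^sup>2" and s0: "0 \<le> s"
      using cap_height_bounds(3)[OF assms(2,3)] by (auto simp: s_def)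
    have w2: "(norm w)\<^sup>2 = (cap_height d)\<^sup>2 + y\<^sup>2" using chord by (simp add: cmod_power2 y_def)
    have "(norm w)\<^sup>2 \<le> 1" using assms(1) by (simp add: power_le_one)
    then have "\<bar>y\<bar> \<le> s" using w2 s2 s0 abs_le_square_iff[of y s] by simp
    have bc: "b * cnj b = 1" using b(1) by (simp add: complex_norm_square[symmetric])
    have diff: "norm (1 - w * cnj c) = norm (c - w)" if "norm c = 1" for c
    proof -
      have "c * (1 - w * cnj c) = c - w * (c * cnj c)" by (simp add: algebra_simps)
      also have "c * cnj c = 1" using that by (simp add: complex_norm_square[symmetric])
      finally show ?thesis using that by (metis mult.right_neutral mult_1 norm_mult)
    qed
    have "norm (1 - w * cnj b) = \<bar>s - y\<bar>"
      using diff[OF b(1)] chord by (simp add: b_def cap_corner_def cmod_def y_def s_def)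
    moreover have "norm (1 - w * b) = \<bar>- s - y\<bar>"
      using diff[OF b(2)] chord by (simp add: b_def cap_corner_def cmod_def y_def s_def)
    ultimately have "norm (1 - w * cnj b) * norm (1 - w * b) = (s - y) * (s + y)"
      using \<open>\<bar>y\<bar> \<le> s\<close> by simp
    then show ?thesis using s2 w2 by (simp add: power2_eq_square algebra_simps)
  qed
  have "norm (barrier d \<Lambda> w) = (norm (1 - w * cnj b) * norm (1 - w * b)) /
      (norm (1 + d - w * cnj b) * norm (1 + d - w * b)) * norm (exp (- (4 * \<Lambda> * d / (1 + d - w))))"
    by (simp add: barrier_def b_def norm_mult norm_divide)
  also have "\<dots> \<le> (1 - (norm w)\<^sup>2) / (d * d) * exp (- \<Lambda>)"
    unfolding prod using assms Re_shift_ge(2)[OF assms(1) b(1) assms(2)] Re_shift_ge(2)[OF assms(1) b(2) assms(2)]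
    by (intro mult_mono frac_le ex) (auto simp: power_le_one)
  finally show ?thesis by (simp add: power2_eq_square)
qed

lemma norm_barrier_0:
  assumes "0 < d" "d \<le> 1" "0 \<le> \<Lambda>"
  shows "exp (- (2 * d + 4 * \<Lambda> * d)) \<le> norm (barrier d \<Lambda> 0)"
proof -
  have "exp (-d) \<le> 1 / (1 + d)"
    using assms exp_ge_add_one_self[of d] by (simp add: exp_minus field_simps)
  moreover have "exp (- (4 * \<Lambda> * d)) \<le> exp (- (4 * \<Lambda> * d / (1 + d)))"
    using assms by (auto simp: divide_le_eq intro!: mult_left_mono)
  ultimately have "exp (-d) * exp (-d) * exp (- (4 * \<Lambda> * d)) \<le>
      1 / (1 + d) * (1 / (1 + d)) * exp (- (4 * \<Lambda> * d / (1 + d)))"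
    using assms by (intro mult_mono) auto
  also have "\<dots> = norm (barrier d \<Lambda> 0)"
  proof -
    have "norm (1 + complex_of_real d) = 1 + d" using assms
      by (metis norm_of_real of_real_1 of_real_add abs_of_nonneg add_nonneg_nonneg less_imp_le zero_le_one)
    moreover have "4 * complex_of_real \<Lambda> * d / (1 + d) = of_real (4 * \<Lambda> * d / (1 + d))"
      by simp
    then have "Re (4 * complex_of_real \<Lambda> * d / (1 + d)) = 4 * \<Lambda> * d / (1 + d)"
      by (simp only: Re_complex_of_real)
    ultimately show ?thesis by (simp add: barrier_def norm_mult norm_divide)
  qed
  finally show ?thesis by (simp add: exp_add[symmetric] exp_diff[symmetric] algebra_simps)
qed

lemma holomorphic_barrier:
  assumes "0 < d" "d \<le> 1"
  shows "barrier d \<Lambda> holomorphic_on ball 0 1" "continuous_on (cball 0 1) (barrier d \<Lambda>)"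
proof -
  have nz: "1 + d - w * c \<noteq> 0" if "norm w \<le> 1" "norm c = 1" for w c :: complex
    using Re_shift_ge(2)[OF that assms(1)] assms by auto
  have b: "norm (cap_corner d) = 1" "norm (cnj (cap_corner d)) = 1" using norm_cap_corner assms by auto
  have "1 + d - w \<noteq> 0" if "norm w \<le> 1" for w :: complex using nz[of w 1] that by simp
  note nz = nz[OF _ b(1)] nz[OF _ b(2)] this
  show "barrier d \<Lambda> holomorphic_on ball 0 1" unfolding barrier_def [abs_def]
    by (intro holomorphic_intros) (use nz in auto)
  show "continuous_on (cball 0 1) (barrier d \<Lambda>)" unfolding barrier_def [abs_def]
    by (intro continuous_intros) (use nz in auto)
qed

text \<open>
  The loss \<open>- ln (norm (barrier d \<Lambda> 0))\<close> for \<open>\<Lambda> = ln (2 * N / d\<^sup>2)\<close>, rounded up.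
\<close>

definition cap_cost :: "nat \<Rightarrow> real \<Rightarrow> real"
  where "cap_cost N d = d * (2 + 4 * ln (2 * N / d\<^sup>2))"

lemma cap_cost_ge:
  assumes "0 < d" "d \<le> 1" "N \<ge> 1"
  shows "0 \<le> ln (2 * N / d\<^sup>2)" "2 * d \<le> cap_cost N d" 
proof -
  have "d\<^sup>2 \<le> 1" using assms by (simp add: power_le_one)
  then have "1 \<le> 2 * N / d\<^sup>2" using assms by (simp add: le_divide_eq) 
  then show "0 \<le> ln (2 * N / d\<^sup>2)" by simp
  then show "2 * d \<le> cap_cost N d" using assms by (simp add: cap_cost_def algebra_simps)
qed

text \<open>
  The maximum principle for \<open>Q * G\<close> on what is left of the disc when all segments are removed.
  On the chord of \<open>(N, d)\<close> the factor with this index is at most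
  \<open>2 * N * (1 - norm z) / d\<^sup>2 * exp (- \<Lambda>)\<close>, which the choice
  \<open>\<Lambda> = ln (1 / \<eta>) + ln (2 * N / d\<^sup>2)\<close> turns into \<open>\<eta> * (1 - norm z)\<close>. At the origin the first
  summand of \<open>\<Lambda>\<close> costs a factor \<open>\<eta> powr (4 * D)\<close>, where \<open>D\<close> is the sum of all \<open>d\<close>, and the bound on
  the costs makes the exponent at most \<open>1 / 2\<close>.
\<close>

theorem constant_coefficient_bound:
  fixes Q :: "complex \<Rightarrow> complex" and I :: "(nat \<times> real) set"
  assumes fin: "finite I" and I: "\<And>N d. (N, d) \<in> I \<Longrightarrow> N \<ge> 1 \<and> 0 < d \<and> d \<le> 1"
    and holo: "Q holomorphic_on UNIV" and C: "1 \<le> C"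
    and growth: "\<And>z. norm z < 1 \<Longrightarrow> norm (Q z) \<le> C / (1 - norm z)"
    and eta: "0 < \<eta>" "\<eta> \<le> 1"
    and small: "\<And>z. norm z = 1 \<Longrightarrow> (\<forall>(N, d)\<in>I. Re (z ^ N) \<le> cap_height d) \<Longrightarrow> norm (Q z) \<le> \<eta>"
    and cost: "(\<Sum>(N, d)\<in>I. cap_cost N d) \<le> 1 / 4"
  shows "norm (Q 0) \<le> C * exp 1 * sqrt \<eta>"
proof -
  define L where "L = - ln \<eta>"
  have L: "0 \<le> L" "exp (-L) = \<eta>" using eta by (auto simp: L_def)
  define \<Lambda> where "\<Lambda> = (\<lambda>(N :: nat, d). L + ln (2 * N / d\<^sup>2))"
  define g where "g = (\<lambda>(N, d) z. barrier d (\<Lambda> (N, d)) (z ^ N))"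
  define G where "G = (\<lambda>z. \<Prod>i\<in>I. g i z)"
  define S where "S = {z. norm z < 1 \<and> (\<forall>(N, d)\<in>I. Re (z ^ N) < cap_height d)}"
  have Lam: "0 \<le> \<Lambda> (N, d)" if "(N, d) \<in> I" for N d
    using L cap_cost_ge(1) I[OF that] by (auto simp: \<Lambda>_def)
  have pow: "norm (z ^ N) \<le> 1" if "norm z \<le> 1" for z :: complex and N
    using that by (simp add: norm_power power_le_one)
  have g1: "norm (g i z) \<le> 1" if "i \<in> I" "norm z \<le> 1" for i z
    using norm_barrier_le_1[OF pow[OF that(2)]] I Lam that(1) by (cases i) (auto simp: g_def)
  have G1: "norm (G z) \<le> 1" if "norm z \<le> 1" for z
    using that g1 by (auto simp: G_def simp flip: prod_norm intro!: prod_le_1)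
  have "open S"
  proof -
    have "S = ball 0 1 \<inter> (\<Inter>(N, d)\<in>I. {z. Re (z ^ N) < cap_height d})"
      by (auto simp: S_def)
    moreover have "open {z::complex. Re (z ^ N) < cap_height d}" for N d
      by (intro open_Collect_less continuous_intros)
    ultimately show ?thesis using fin by (auto intro!: open_Int open_INT)
  qed
  have clos: "closure S \<subseteq> {z. norm z \<le> 1 \<and> (\<forall>(N, d)\<in>I. Re (z ^ N) \<le> cap_height d)}" (is "_ \<subseteq> ?T")
  proof (rule closure_minimal)
    have "?T = cball 0 1 \<inter> (\<Inter>(N, d)\<in>I. {z. Re (z ^ N) \<le> cap_height d})" by auto
    moreover have "closed {z::complex. Re (z ^ N) \<le> cap_height d}" for N d
      by (intro closed_Collect_le continuous_intros)
    ultimately show "closed ?T" by (auto intro!: closed_Int closed_INT)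
    show "S \<subseteq> ?T" by (auto simp: S_def intro: less_imp_le)
  qed
  have holg: "g i holomorphic_on S" "continuous_on (closure S) (g i)" if "i \<in> I" for i
  proof -
    obtain N d where i: "i = (N, d)" by (cases i)
    have "(\<lambda>z. z ^ N) ` S \<subseteq> ball 0 1"
      using I[of N d] that i by (auto simp: S_def norm_power intro!: power_less_one_iff[THEN iffD2])
    then have "barrier d (\<Lambda> i) \<circ> (\<lambda>z. z ^ N) holomorphic_on S"
      using I[of N d] that i
      by (intro holomorphic_on_compose_gen[OF _ holomorphic_barrier(1)] holomorphic_intros) auto
    moreover have "(\<lambda>z. z ^ N) ` closure S \<subseteq> cball 0 1" using clos pow by auto
    then have "continuous_on (closure S) (barrier d (\<Lambda> i) \<circ> (\<lambda>z. z ^ N))"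
      using I[of N d] that i
      by (intro continuous_on_compose continuous_on_subset[OF holomorphic_barrier(2)] continuous_intros) auto
    moreover have "g i = barrier d (\<Lambda> i) \<circ> (\<lambda>z. z ^ N)" by (auto simp: g_def i)
    ultimately show "g i holomorphic_on S" "continuous_on (closure S) (g i)" by simp_all
  qed
  have contQ: "continuous_on A Q" for A
    using holo holomorphic_on_imp_continuous_on continuous_on_subset by blast
  have QG: "norm (Q 0 * G 0) \<le> C * \<eta>"
  proof (rule maximum_modulus_frontier[where S = S and f = "\<lambda>z. Q z * G z"])
    show "(\<lambda>z. Q z * G z) holomorphic_on interior S"
      unfolding G_def interior_open[OF \<open>open S\<close>]
      by (intro holomorphic_on_mult holomorphic_on_prod holg holomorphic_on_subset[OF holo]) auto
    show "continuous_on (closure S) (\<lambda>z. Q z * G z)"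
      unfolding G_def by (intro continuous_on_mult continuous_on_prod holg contQ)
    show "bounded S" using bounded_ball[of 0 1] by (rule bounded_subset) (auto simp: S_def)
    show "0 \<in> S"
    proof -
      have "Re (0 ^ N) < cap_height d" if "(N, d) \<in> I" for N d
        using cap_height_bounds(1)[of d] I[OF that] by (simp add: power_0_left)
      then show ?thesis by (auto simp: S_def)
    qed
  next
    fix z assume "z \<in> frontier S"
    then have z: "norm z \<le> 1" "\<forall>(N, d)\<in>I. Re (z ^ N) \<le> cap_height d" and nS: "z \<notin> S"
      using clos \<open>open S\<close> by (auto simp: frontier_def interior_open)
    show "norm (Q z * G z) \<le> C * \<eta>"
    proof (cases "norm z = 1")
      case True
      have "norm (Q z * G z) \<le> \<eta> * 1" unfolding norm_mult
        using small[OF True z(2)] G1[OF z(1)] eta by (intro mult_mono) auto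
      also have "\<dots> \<le> C * \<eta>" using C eta by simp
      finally show ?thesis .
    next
      case False
      then have lt: "norm z < 1" using z(1) by simp
      then obtain N d where i: "(N, d) \<in> I" "Re (z ^ N) = cap_height d"
      proof -
        obtain N d where i: "(N, d) \<in> I" "\<not> Re (z ^ N) < cap_height d"
          using nS lt unfolding S_def by auto
        then show ?thesis using that[of N d] z(2) by force
      qed
      note Nd = I[OF i(1)]
      have "norm (G z) = norm (g (N, d) z) * (\<Prod>j\<in>I - {(N, d)}. norm (g j z))"
        unfolding G_def prod_norm[symmetric] using fin i(1) by (rule prod.remove)
      also have "\<dots> \<le> norm (g (N, d) z) * 1"
        using g1 z(1) by (intro mult_left_mono prod_le_1) auto
      also have "\<dots> \<le> (1 - (norm (z ^ N))\<^sup>2) / d\<^sup>2 * exp (- \<Lambda> (N, d))"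
        using norm_barrier_on_chord[OF pow[OF z(1)] _ _ Lam[OF i(1)] i(2)] Nd by (simp add: g_def)
      also have "\<dots> \<le> (2 * N * (1 - norm z)) / d\<^sup>2 * exp (- \<Lambda> (N, d))"
      proof (intro mult_right_mono divide_right_mono)
        \<comment> \<open>\<open>1 - r ^ (2 * N) \<le> 2 * N * (1 - r)\<close>, where \<open>r = norm z\<close>.\<close>
        have "1 + real (2 * N) * (norm z - 1) \<le> (1 + (norm z - 1)) ^ (2 * N)"
          by (rule Bernoulli_inequality) (use norm_ge_zero[of z] in linarith)
        then show "1 - (norm (z ^ N))\<^sup>2 \<le> 2 * N * (1 - norm z)"
          by (simp add: norm_power power_mult[symmetric] mult.commute algebra_simps)
      qed auto
      also have "exp (- \<Lambda> (N, d)) = \<eta> * (d\<^sup>2 / (2 * N))"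
        using Nd L by (simp add: \<Lambda>_def exp_diff exp_minus field_simps)
      also have "2 * N * (1 - norm z) / d\<^sup>2 * (\<eta> * (d\<^sup>2 / (2 * N))) = \<eta> * (1 - norm z)"
        using Nd by (simp add: field_simps)
      finally have "norm (G z) \<le> \<eta> * (1 - norm z)" .
      then have "norm (Q z * G z) \<le> C / (1 - norm z) * (\<eta> * (1 - norm z))"
        unfolding norm_mult using growth[OF lt] C lt by (intro mult_mono) auto
      then show ?thesis using lt by simp
    qed
  qed
  moreover have "exp (- 1) * sqrt \<eta> \<le> norm (G 0)"
  proof -
    have factor: "exp (- (cap_cost N d + 2 * L * cap_cost N d)) \<le> norm (g (N, d) 0)" if "(N, d) \<in> I" for N d
    proof -
      note Nd = I[OF that]
      have "2 * d + 4 * \<Lambda> (N, d) * d = cap_cost N d + 4 * L * d"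
        by (simp add: \<Lambda>_def cap_cost_def algebra_simps)
      also have "\<dots> \<le> cap_cost N d + 2 * L * cap_cost N d"
        using cap_cost_ge(2)[of d N] Nd L(1) mult_left_mono[of "2 * d" "cap_cost N d" "2 * L"] by simp
      finally show ?thesis
        using norm_barrier_0[OF _ _ Lam[OF that], of d] Nd
        by (auto simp: g_def power_0_left intro: order_trans[rotated])
    qed
    define s where "s = (\<Sum>(N, d)\<in>I. cap_cost N d)"
    have "s + 2 * L * s \<le> 1 + L / 2" 
      using mult_left_mono[OF cost, of "2 * L"] cost L(1) by (simp add: s_def)
    then have "exp (- 1 - L / 2) \<le> exp (- (s + 2 * L * s))" by simp
    also have "\<dots> = exp (\<Sum>(N, d)\<in>I. - (cap_cost N d + 2 * L * cap_cost N d))"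
      by (simp add: s_def sum.distrib sum_negf sum_distrib_left case_prod_unfold sum_subtractf)
    also have "\<dots> = (\<Prod>(N, d)\<in>I. exp (- (cap_cost N d + 2 * L * cap_cost N d)))"
      using fin by (simp add: exp_sum case_prod_unfold)
    also have "\<dots> \<le> (\<Prod>i\<in>I. norm (g i 0))"
      using factor by (intro prod_mono) auto
    also have "\<dots> = norm (G 0)" by (simp add: G_def prod_norm)
    also have "exp (- 1 - L / 2) = exp (-1) * sqrt \<eta>"
    proof -
      have "sqrt \<eta> = exp (- L / 2)"
        using L(2) by (intro real_sqrt_unique) (simp_all add: power2_eq_square exp_add[symmetric])
      then show ?thesis by (simp add: exp_add[symmetric])
    qed
    finally show ?thesis .
  qed
  ultimately have "norm (Q 0) * (exp (-1) * sqrt \<eta>) \<le> C * \<eta>"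
    using mult_left_mono[of "exp (-1) * sqrt \<eta>" "norm (G 0)" "norm (Q 0)"] by (simp add: norm_mult)
  also have "C * \<eta> = C * sqrt \<eta> * sqrt \<eta>" using eta by simp
  finally have "(norm (Q 0) * exp (-1)) * sqrt \<eta> \<le> (C * sqrt \<eta>) * sqrt \<eta>"
    by (simp only: mult.assoc)
  then have "norm (Q 0) * exp (-1) \<le> C * sqrt \<eta>"
    by (rule mult_right_le_imp_le) (use eta in simp)
  then have "norm (Q 0) * exp (-1) * exp 1 \<le> C * sqrt \<eta> * exp 1" by (rule mult_right_mono) simp
  then show ?thesis by (simp add: mult.assoc exp_add[symmetric] mult.commute[of "sqrt _"])
qed

section \<open>Arcs and flat trigonometric polynomials\<close>

text \<open>
  Chebyshev's inequality for \<open>S z = 1 + w + \<dots> + w ^ (D - 1)\<close> with \<open>w = z ^ N\<close>: the mean of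
  \<open>(norm (S z))\<^sup>2\<close> is \<open>D\<close>, while \<open>norm (S z) \<ge> D / 2\<close> where \<open>norm (w - 1) \<le> d\<close>, as long as
  \<open>D\<close> is about \<open>1 / (2 * d)\<close>.
\<close>

lemma measure_cap_le:
  assumes d: "0 < d" "d \<le> 1" and N: "N \<ge> 1"
  shows "{z \<in> circle. cap_height d < Re (z ^ N)} \<in> sets circle_measure" (is "?A \<in> _")
    and "measure circle_measure {z \<in> circle. cap_height d < Re (z ^ N)} \<le> 8 * d"
proof -
  have "?A = circle \<inter> {z. cap_height d < Re (z ^ N)}" by auto
  moreover have "open {z :: complex. cap_height d < Re (z ^ N)}"
    by (intro open_Collect_less continuous_intros)
  ultimately show A: "?A \<in> sets circle_measure"
    by (auto simp: sets_circle_measure sets_restrict_space)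
  \<comment> \<open>The largest \<open>D\<close> for which all \<open>i < D\<close> satisfy \<open>i * d \<le> 1 / 2\<close>.\<close>
  define D where "D = nat \<lfloor>1 / (2 * d)\<rfloor> + 1"
  have D: "1 / (2 * d) \<le> D" "real i * d \<le> 1 / 2" if "i < D" for i
  proof -
    have 0: "0 \<le> 1 / (2 * d)" using d by simp
    then show "1 / (2 * d) \<le> D" unfolding D_def by linarith
    have "real i \<le> 1 / (2 * d)" using that 0 unfolding D_def by linarith
    then show "real i * d \<le> 1 / 2" using d by (simp add: field_simps)
  qed
  have "0 < D" by (simp add: D_def)
  define S where "S z = (\<Sum>i<D. z ^ (N * i))" for z :: complex
  have contS: "continuous_on circle S" unfolding S_def [abs_def] by (intro continuous_intros)
  have "complex_of_real (LINT z|circle_measure. (norm (S z))\<^sup>2) =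
      (LINT z|circle_measure. complex_of_real ((norm (S z))\<^sup>2))"
    by (rule integral_complex_of_real[symmetric])
  also have "\<dots> = (LINT z|circle_measure. (\<Sum>i<D. \<Sum>j<D. z powi (int N * (int i - int j))))"
  proof (intro Bochner_Integration.integral_cong refl)
    fix z assume "z \<in> space circle_measure"
    then have z: "norm z = 1" "z \<noteq> 0" by (auto simp: space_circle_measure)
    then have "z * cnj z = 1" by (simp add: complex_norm_square[symmetric])
    then have cz: "cnj z = inverse z" by (simp add: inverse_unique)
    have "complex_of_real ((norm (S z))\<^sup>2) = S z * cnj (S z)" by (rule complex_norm_square)
    also have "\<dots> = (\<Sum>i<D. \<Sum>j<D. z ^ (N * i) * inverse z ^ (N * j))"
      by (simp add: S_def sum_product cz)
    also have "\<dots> = (\<Sum>i<D. \<Sum>j<D. z powi (int N * (int i - int j)))"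
      using z(2) by (intro sum.cong refl)
        (simp add: right_diff_distrib power_int_diff divide_inverse power_inverse power_int_inverse flip: power_int_of_nat)
    finally show "complex_of_real ((norm (S z))\<^sup>2) = (\<Sum>i<D. \<Sum>j<D. z powi (int N * (int i - int j)))" .
  qed
  also have "\<dots> = (\<Sum>i<D. \<Sum>j<D. (LINT z|circle_measure. z powi (int N * (int i - int j))))"
    by (simp add: Bochner_Integration.integral_sum integrable_circle continuous_on_circle_powi)
  also have "\<dots> = (\<Sum>i<D. \<Sum>j<D. if i = j then 1 else 0)"
    using N by (intro sum.cong refl) (simp add: integral_circle_powi)
  also have "\<dots> = of_real (real D)" by simp
  finally have mean: "(LINT z|circle_measure. (norm (S z))\<^sup>2) = D" by (simp only: of_real_eq_iff)
  have low: "D / 2 \<le> norm (S z)" if "z \<in> ?A" for z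
  proof -
    define w where "w = z ^ N"
    have w: "norm w = 1" "cap_height d < Re w" using that by (auto simp: w_def norm_power)
    have "(norm (w - 1))\<^sup>2 = (norm w)\<^sup>2 + 1 - 2 * Re w"
      by (simp only: cmod_power2) (simp add: power2_eq_square algebra_simps)
    also have "\<dots> \<le> d\<^sup>2" using w by (simp add: cap_height_def)
    finally have wd: "norm (w - 1) \<le> d" using d by (simp add: power2_le_iff_abs_le)
    have "1 / 2 \<le> Re (w ^ i)" if "i < D" for i
    proof -
      have "norm (w ^ i - 1) \<le> real i * norm (w - 1)"
        using norm_power_diff[of w 1 i] w by simp
      also have "\<dots> \<le> real i * d" using wd by (intro mult_left_mono) auto
      finally have "norm (w ^ i - 1) \<le> 1 / 2" using D(2)[OF that] by linarith
      then show ?thesis using abs_Re_le_cmod[of "w ^ i - 1"] by simp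
    qed
    then have "(\<Sum>i<D. 1 / 2) \<le> (\<Sum>i<D. Re (w ^ i))" by (intro sum_mono) auto
    also have "\<dots> = Re (S z)" by (simp add: S_def w_def power_mult)
    finally show ?thesis using complex_Re_le_cmod[of "S z"] by simp
  qed
  have "measure circle_measure ?A * (D / 2)\<^sup>2 = (LINT z|circle_measure. indicator ?A z * (D / 2)\<^sup>2)"
    using A by simp
  also have "\<dots> \<le> (LINT z|circle_measure. (norm (S z))\<^sup>2)"
  proof (rule integral_mono)
    show "integrable circle_measure (\<lambda>z. indicat_real ?A z * (D / 2)\<^sup>2)"
      using A by (intro integrable_mult_left) (simp add: circle.emeasure_finite less_top[symmetric])
    show "integrable circle_measure (\<lambda>z. (norm (S z))\<^sup>2)"
      by (intro integrable_circle continuous_intros contS)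
    show "indicat_real ?A z * (D / 2)\<^sup>2 \<le> (norm (S z))\<^sup>2" for z
      using low[of z] power_mono[of "D / 2" "norm (S z)" 2] by (auto simp: indicator_def)
  qed
  finally have "measure circle_measure ?A * D \<le> 4"
    using mean \<open>0 < D\<close> by (simp add: power2_eq_square field_simps)
  moreover have "measure circle_measure ?A * (1 / (2 * d)) \<le> measure circle_measure ?A * D"
    using D(1)[OF \<open>0 < D\<close>] by (intro mult_left_mono) auto
  ultimately have "measure circle_measure ?A * (1 / (2 * d)) \<le> 4" by linarith
  then show "measure circle_measure ?A \<le> 8 * d" using d by (simp add: field_simps)
qed

text \<open>
  By induction: the ratio of consecutive central binomial coefficients is
  \<open>2 * (2 * n + 1) / (n + 1)\<close>, and \<open>2 * sqrt (n * (n + 1)) \<le> 2 * n + 1\<close>.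
\<close>

lemma power4_le_central_binomial:
  assumes "n \<ge> 1"
  shows "4 ^ n \<le> 2 * sqrt n * real ((2 * n) choose n)"
  using assms
proof (induction n rule: nat_induct_at_least)
  case base
  then show ?case by (simp add: choose_two)
next
  case (Suc n)
  have step: "real (Suc n) * real ((2 * Suc n) choose Suc n) = 2 * (2 * real n + 1) * real ((2 * n) choose n)"
  proof -
    have "Suc n * ((2 * Suc n) choose Suc n) = (2 * n + 2) * (Suc (2 * n) choose n)"
      using Suc_times_binomial_eq[of "Suc (2 * n)" n] by simp
    moreover have "Suc n * (Suc (2 * n) choose n) = (2 * n + 1) * ((2 * n) choose n)"
      using binomial_absorb_comp[of "Suc (2 * n)" n] by simp
    ultimately have "Suc n * (Suc n * ((2 * Suc n) choose Suc n)) = Suc n * (2 * (2 * n + 1) * ((2 * n) choose n))"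
      by (simp add: algebra_simps)
    then have "Suc n * ((2 * Suc n) choose Suc n) = 2 * (2 * n + 1) * ((2 * n) choose n)"
      by (simp only: mult_cancel1) simp
    then have "real (Suc n * ((2 * Suc n) choose Suc n)) = real (2 * (2 * n + 1) * ((2 * n) choose n))"
      by (simp only:)
    then show ?thesis by (simp add: algebra_simps del: binomial_Suc_Suc)
  qed
  have amgm: "2 * sqrt n * sqrt (Suc n) \<le> 2 * real n + 1"
    using sum_squares_bound[of "sqrt n" "sqrt (Suc n)"] by (simp add: power2_eq_square)
  have "4 ^ Suc n * sqrt (Suc n) \<le> 4 * (2 * sqrt n * real ((2 * n) choose n)) * sqrt (Suc n)"
    using Suc.IH by (intro mult_right_mono) auto
  also have "\<dots> = 4 * (2 * sqrt n * sqrt (Suc n)) * real ((2 * n) choose n)" by simp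
  also have "\<dots> \<le> 4 * (2 * real n + 1) * real ((2 * n) choose n)"
    using amgm by (intro mult_right_mono mult_left_mono) auto
  also have "\<dots> = 2 * (sqrt (Suc n) * sqrt (Suc n)) * real ((2 * Suc n) choose Suc n)"
  proof -
    have "2 * (sqrt (Suc n) * sqrt (Suc n)) * real ((2 * Suc n) choose Suc n) =
        2 * (real (Suc n) * real ((2 * Suc n) choose Suc n))"
      by (simp del: binomial_Suc_Suc of_nat_Suc)
    also have "\<dots> = 4 * (2 * real n + 1) * real ((2 * n) choose n)"
      unfolding step by simp
    finally show ?thesis by (rule sym)
  qed
  also have "\<dots> = (2 * sqrt (Suc n) * real ((2 * Suc n) choose Suc n)) * sqrt (Suc n)"
    by (simp only: mult_ac)
  finally show ?case
    by (rule mult_right_le_imp_le) simp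
qed

text \<open>
  The coefficients of \<open>(1 + w) ^ (2 * n) * w powi (- n)\<close>, normalised to have mean \<open>1\<close>. They lie
  between \<open>0\<close> and \<open>1\<close> and form a bell of width \<open>sqrt n\<close>, so that the sum of their \<open>p\<close>-th powers is
  of order \<open>sqrt n\<close> and not of the order of the degree.
\<close>

definition peak_coeff :: "nat \<Rightarrow> int \<Rightarrow> real"
  where "peak_coeff n i = real ((2 * n) choose nat (i + n)) / real ((2 * n) choose n)"

definition peak :: "nat \<Rightarrow> complex \<Rightarrow> complex"
  where "peak n w = (\<Sum>i\<in>{- int n..int n}. of_real (peak_coeff n i) * w powi i)"

lemma peak_coeff_bounds: "0 \<le> peak_coeff n i" "peak_coeff n i \<le> 1" "peak_coeff n 0 = 1"
  using binomial_maximum'[of n "nat (i + n)"] by (auto simp: peak_coeff_def divide_le_eq)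

lemma sum_shift: "(\<Sum>i\<in>{- int n..int n}. f (i + int n)) = (\<Sum>k\<le>2 * n. f (int k))"
  by (rule sum.reindex_bij_witness[of _ "\<lambda>k. int k - int n" "\<lambda>i. nat (i + int n)"]) auto

lemma sum_peak_coeff_le:
  assumes "n \<ge> 1"
  shows "(\<Sum>i\<in>{- int n..int n}. peak_coeff n i) \<le> 2 * sqrt n"
proof -
  have "(\<Sum>i\<in>{- int n..int n}. peak_coeff n i) = (\<Sum>k\<le>2 * n. real ((2 * n) choose k)) / real ((2 * n) choose n)"
    unfolding peak_coeff_def
    using sum_shift[where n = n and f = "\<lambda>k. real ((2 * n) choose nat k) / real ((2 * n) choose n)"]
    by (simp add: sum_divide_distrib)
  also have "(\<Sum>k\<le>2 * n. real ((2 * n) choose k)) = 4 ^ n"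
    using choose_row_sum[of "2 * n"] by (simp add: power_mult flip: of_nat_sum)
  finally show ?thesis
    using power4_le_central_binomial[OF assms] by (simp add: divide_le_eq)
qed

text \<open>
  By the binomial theorem \<open>norm (peak n w)\<close> is \<open>(2 + 2 * Re w) ^ n\<close> divided by the central
  binomial coefficient, and \<open>2 + 2 * Re w \<le> 4 * (1 - d\<^sup>2 / 4)\<close> off the arc.
\<close>

lemma norm_peak_le:
  fixes d :: real
  assumes "n \<ge> 1" "norm w = 1" "Re w \<le> cap_height d" "0 < d" "d \<le> 1"
  shows "norm (peak n w) \<le> 2 * sqrt n * exp (- (n * d\<^sup>2 / 4))"
proof -
  have w: "w \<noteq> 0" using assms by auto
  define B where "B = real ((2 * n) choose n)"
  have B: "B > 0" by (simp add: B_def)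
  have "peak n w = (\<Sum>i\<in>{- int n..int n}. of_real (real ((2 * n) choose nat (i + n)) / B) * (w powi (i + n) / w ^ n))"
    using w by (simp add: peak_def peak_coeff_def B_def power_int_add)
  also have "\<dots> = (\<Sum>k\<le>2 * n. of_real (real ((2 * n) choose k) / B) * (w powi (int k) / w ^ n))"
    using sum_shift[where n = n and f = "\<lambda>k. of_real (real ((2 * n) choose nat k) / B) * (w powi k / w ^ n)"]
    by simp
  also have "\<dots> = (w + 1) ^ (2 * n) / (w ^ n * of_real B)"
    by (simp add: binomial_ring sum_divide_distrib mult_ac)
  finally have "norm (peak n w) = ((norm (w + 1))\<^sup>2) ^ n / B"
    using B assms(2) by (simp add: norm_divide norm_mult norm_power power_mult)
  also have "(norm (w + 1))\<^sup>2 = (norm w)\<^sup>2 + 1 + 2 * Re w"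
    by (simp only: cmod_power2) (simp add: power2_eq_square algebra_simps)
  also have "\<dots> ^ n / B \<le> (4 * exp (- (d\<^sup>2 / 4))) ^ n / B"
  proof (intro divide_right_mono power_mono)
    have "1 - d\<^sup>2 / 4 \<le> exp (- (d\<^sup>2 / 4))" using exp_ge_add_one_self[of "- (d\<^sup>2 / 4)"] by simp
    then show "(norm w)\<^sup>2 + 1 + 2 * Re w \<le> 4 * exp (- (d\<^sup>2 / 4))"
      using assms by (simp add: cap_height_def)
    show "0 \<le> (norm w)\<^sup>2 + 1 + 2 * Re w"
      using abs_Re_le_cmod[of w] assms(2) by simp
  qed (use B in simp)
  also have "\<dots> = 4 ^ n / B * exp (- (n * d\<^sup>2 / 4))"
    by (simp add: power_mult_distrib exp_of_nat_mult[symmetric])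
  also have "\<dots> \<le> 2 * sqrt n * exp (- (n * d\<^sup>2 / 4))"
    using power4_le_central_binomial[OF assms(1)] B
    by (intro mult_right_mono) (auto simp: divide_le_eq B_def)
  finally show ?thesis .
qed

text \<open>
  The spectra of \<open>peak n (z ^ N)\<close> for different \<open>N\<close> overlap only at \<open>0\<close>, although the exponents are
  consecutive. Indeed, if \<open>(M + a) * i = (M + b) * i'\<close> with \<open>a, b < K\<close>, then
  \<open>M * (i - i') = b * i' - a * i\<close>; as \<open>i\<close> and \<open>i'\<close> have the same sign, the right side is at most
  \<open>K * n < M\<close> in absolute value. Consecutive exponents keep \<open>N\<close> polynomial in \<open>K\<close> and \<open>n\<close>, which
  the logarithm in the cost requires; lacunary ones would be exponential in \<open>K\<close>.
\<close>

lemma frequencies_inj: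
  fixes n K :: nat
  defines "M \<equiv> K * (n + 1)"
  shows "inj_on (\<lambda>(N, i). int N * i) ({M..<M + K} \<times> ({- int n..int n} - {0}))"
proof (rule inj_onI)
  fix x y
  assume xy: "x \<in> {M..<M + K} \<times> ({- int n..int n} - {0})" "y \<in> {M..<M + K} \<times> ({- int n..int n} - {0})"
    and eq0: "(\<lambda>(N, i). int N * i) x = (\<lambda>(N, i). int N * i) y"
  obtain N i N' i' where x: "x = (N, i)" and y: "y = (N', i')" by (cases x, cases y)
  have N: "M \<le> N" "N < M + K" "M \<le> N'" "N' < M + K"
    and i: "- int n \<le> i" "i \<le> int n" "i \<noteq> 0" "- int n \<le> i'" "i' \<le> int n" "i' \<noteq> 0"
    and eq: "int N * i = int N' * i'"
    using xy eq0 by (auto simp: x y)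
  define a where "a = int N - int M"
  define b where "b = int N' - int M"
  have ab: "0 \<le> a" "a < K" "0 \<le> b" "b < K" using N by (auto simp: a_def b_def)
  then have "0 < int K" by linarith
  have eq': "int M * (i - i') = b * i' - a * i"
    using eq by (simp add: a_def b_def algebra_simps)
  have "N > 0" "N' > 0" using N ab by (auto simp: M_def)
  then have sgn: "0 < i \<longleftrightarrow> 0 < i'" using eq
    by (metis of_nat_0_less_iff zero_less_mult_pos zero_less_mult_iff)
  have bnd: "0 \<le> c * \<bar>j\<bar>" "c * \<bar>j\<bar> \<le> int K * int n" if "0 \<le> c" "c < int K" "\<bar>j\<bar> \<le> int n" for c j
    using that mult_mono[of c "int K" "\<bar>j\<bar>" "int n"] by auto
  have "\<bar>b * i' - a * i\<bar> = \<bar>b * \<bar>i'\<bar> - a * \<bar>i\<bar>\<bar>"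
    using sgn i by (cases "0 < i") (auto simp: abs_minus_commute)
  also have "\<dots> \<le> int K * int n"
  proof -
    have "\<bar>i\<bar> \<le> int n" "\<bar>i'\<bar> \<le> int n" using i by auto
    then show ?thesis using bnd[of b i'] bnd[of a i] ab by linarith
  qed
  also have "\<dots> < int M" using \<open>0 < int K\<close> by (simp add: M_def algebra_simps)
  finally have lt: "int M * \<bar>i - i'\<bar> < int M * 1"
    unfolding eq'[symmetric] by (simp add: abs_mult)
  have "i = i'"
  proof (rule ccontr)
    assume "i \<noteq> i'"
    then have "int M * 1 \<le> int M * \<bar>i - i'\<bar>" by (intro mult_left_mono) auto
    then show False using lt by simp
  qed
  then show "x = y" using eq i by (simp add: x y)
qed

text \<open>
  The average of \<open>1 - peak n (z ^ N)\<close> over \<open>K\<close> exponents. Averaging keeps the value near \<open>1\<close> but,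
  by disjointness of the spectra, divides the sum of \<open>p\<close>-th powers of one summand by \<open>K powr (p - 1)\<close>.
\<close>

lemma flat_polynomial:
  fixes n K :: nat and p :: real
  defines "M \<equiv> K * (n + 1)"
  assumes n: "n \<ge> 1" and K: "K \<ge> 1" and p: "p \<ge> 1"
  shows "\<exists>T. trig_polynomial T \<and>
    (\<forall>F. finite F \<longrightarrow> (\<Sum>k\<in>F. norm (fourier_coeff T k) powr p) \<le> K powr (1 - p) * (2 * sqrt n)) \<and>
    (\<forall>z\<in>circle. \<forall>d::real. 0 < d \<longrightarrow> d \<le> 1 \<longrightarrow> (\<forall>N\<in>{M..<M + K}. Re (z ^ N) \<le> cap_height d) \<longrightarrow>
      norm (T z - 1) \<le> 2 * sqrt n * exp (- (n * d\<^sup>2 / 4)))"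
proof -
  define P where "P = {M..<M + K} \<times> ({- int n..int n} - {0})"
  define \<phi> where "\<phi> = (\<lambda>(N, i). int N * i)"
  have inj: "inj_on \<phi> P" using frequencies_inj[of K n] by (simp add: P_def \<phi>_def M_def)
  have fin: "finite P" by (simp add: P_def)
  \<comment> \<open>The frequency \<open>k = N * i\<close> determines \<open>i\<close>, and with it the coefficient.\<close>
  define c where "c k = - complex_of_real (peak_coeff n (snd (inv_into P \<phi> k)) / K)" for k
  have c: "c (\<phi> x) = - complex_of_real (peak_coeff n (snd x) / K)" if "x \<in> P" for x
    using inj that by (simp add: c_def)
  define T where "T z = (\<Sum>k\<in>\<phi> ` P. c k * z powi k)" for z
  have T_eq: "T z - 1 = - (\<Sum>N\<in>{M..<M + K}. peak n (z ^ N)) / K" for z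
  proof -
    have pk: "peak n w - 1 = (\<Sum>i\<in>{- int n..int n} - {0}. of_real (peak_coeff n i) * w powi i)" for w
      unfolding peak_def by (subst sum.remove[of _ 0]) (auto simp: peak_coeff_bounds(3))
    have "T z = (\<Sum>x\<in>P. c (\<phi> x) * z powi (\<phi> x))"
      unfolding T_def by (subst sum.reindex[OF inj]) simp
    also have "\<dots> = (\<Sum>(N, i)\<in>P. - complex_of_real (peak_coeff n i / K) * (z ^ N) powi i)"
    proof (intro sum.cong refl, clarify)
      fix N i assume "(N, i) \<in> P"
      then show "c (\<phi> (N, i)) * z powi \<phi> (N, i) = - complex_of_real (peak_coeff n i / K) * (z ^ N) powi i"
        using c[of "(N, i)"] by (simp add: \<phi>_def power_int_mult)
    qed
    also have "\<dots> = (\<Sum>N\<in>{M..<M + K}. \<Sum>i\<in>{- int n..int n} - {0}. - complex_of_real (peak_coeff n i / K) * (z ^ N) powi i)"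
      unfolding P_def by (subst sum.cartesian_product) simp
    also have "\<dots> = (\<Sum>N\<in>{M..<M + K}. - (peak n (z ^ N) - 1) / K)"
      by (intro sum.cong refl) (simp add: pk sum_divide_distrib sum_negf)
    also have "\<dots> = - (\<Sum>N\<in>{M..<M + K}. peak n (z ^ N)) / K + 1"
      using K by (simp add: sum_divide_distrib[symmetric] sum_negf sum_subtractf field_simps)
    finally show ?thesis by simp
  qed
  show ?thesis
  proof (intro exI[of _ T] conjI allI ballI impI)
    show "trig_polynomial T" unfolding trig_polynomial_def T_def
      using fin by (intro exI[of _ "\<phi> ` P"] exI[of _ c]) auto
    show "(\<Sum>k\<in>F. norm (fourier_coeff T k) powr p) \<le> K powr (1 - p) * (2 * sqrt n)" if "finite F" for F
    proof -
      have T_coeff: "fourier_coeff T k = (if k \<in> \<phi> ` P then c k else 0)" for k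
        unfolding T_def [abs_def] using fin by (intro fourier_coeff_sum_powi) auto
      have "(\<Sum>k\<in>F. norm (fourier_coeff T k) powr p) \<le> (\<Sum>k\<in>F \<union> \<phi> ` P. norm (fourier_coeff T k) powr p)"
        using that fin by (intro sum_mono2) auto
      also have "\<dots> = (\<Sum>k\<in>\<phi> ` P. norm (c k) powr p)"
        using that fin by (intro sum.mono_neutral_cong_right) (auto simp: T_coeff)
      also have "\<dots> = (\<Sum>x\<in>P. (peak_coeff n (snd x) / K) powr p)"
        using peak_coeff_bounds(1)[of n] by (subst sum.reindex[OF inj]) (auto simp: c norm_divide intro!: sum.cong)
      also have "\<dots> = (\<Sum>N\<in>{M..<M + K}. \<Sum>i\<in>{- int n..int n} - {0}. (peak_coeff n i / K) powr p)"
        unfolding P_def by (subst sum.cartesian_product) (simp add: case_prod_unfold)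
      also have "\<dots> = K * (\<Sum>i\<in>{- int n..int n} - {0}. (peak_coeff n i / K) powr p)"
        by simp
      also have "\<dots> \<le> K * (\<Sum>i\<in>{- int n..int n} - {0}. peak_coeff n i * K powr (- p))"
      proof (intro mult_left_mono sum_mono)
        fix i
        have "peak_coeff n i powr p \<le> peak_coeff n i powr 1"
          using peak_coeff_bounds(1,2)[of n i] p by (intro powr_mono') auto
        then show "(peak_coeff n i / K) powr p \<le> peak_coeff n i * K powr (- p)"
          using peak_coeff_bounds(1)[of n i] K
          by (simp add: powr_divide powr_minus divide_right_mono flip: divide_inverse)
      qed auto
      also have "\<dots> = K * K powr (- p) * (\<Sum>i\<in>{- int n..int n} - {0}. peak_coeff n i)"
        by (simp add: sum_distrib_right[symmetric])
      also have "K * K powr (- p) = K powr (1 - p)"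
        using K by (simp add: powr_diff powr_minus divide_inverse)
      also have "(\<Sum>i\<in>{- int n..int n} - {0}. peak_coeff n i) \<le> (\<Sum>i\<in>{- int n..int n}. peak_coeff n i)"
        using peak_coeff_bounds(1) by (intro sum_mono2) auto
      also have "\<dots> \<le> 2 * sqrt n" by (rule sum_peak_coeff_le[OF n])
      finally show ?thesis by (simp add: mult_left_mono)
    qed
    show "norm (T z - 1) \<le> 2 * sqrt n * exp (- (n * d\<^sup>2 / 4))"
      if z: "z \<in> circle" and d: "0 < d" "d \<le> 1" and low: "\<forall>N\<in>{M..<M + K}. Re (z ^ N) \<le> cap_height d" for z and d :: real
    proof -
      have "norm (\<Sum>N\<in>{M..<M + K}. peak n (z ^ N)) \<le> (\<Sum>N\<in>{M..<M + K}. 2 * sqrt n * exp (- (n * d\<^sup>2 / 4)))"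
        using z low d n by (intro sum_norm_le norm_peak_le) (auto simp: norm_power)
      then show ?thesis using K by (simp add: T_eq norm_divide field_simps)
    qed
  qed
qed

text \<open>
  Write \<open>p = 2 + 2 * h\<close> and take \<open>n = K powr (2 + 2 * h)\<close>, \<open>d = K powr (- (1 + h / 2))\<close>. Then
  \<open>K powr (1 - p) * sqrt n = K powr (- h)\<close>, \<open>K * d = K powr (- h / 2)\<close> and
  \<open>n * d\<^sup>2 = K powr h\<close>, so all three bounds hold for large \<open>K\<close>.
\<close>

lemma parameters_exist:
  assumes p: "p > 2" and e: "e > 0"
  obtains K n :: nat and d :: real where "K \<ge> 1" "n \<ge> 1" "0 < d" "d \<le> 1"
    "K powr (1 - p) * (2 * sqrt n) \<le> e"
    "2 * sqrt n * exp (- (n * d\<^sup>2 / 4)) \<le> e"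
    "K * (d * (2 + 4 * ln (4 * real K * (real n + 1) / d\<^sup>2))) < e"
proof -
  define h where "h = (p - 2) / 2"
  have h: "h > 0" "p = 2 + 2 * h" using p by (auto simp: h_def field_simps)
  \<comment> \<open>The factor \<open>2\<close> below \<open>sqrt\<close> leaves room for rounding \<open>n\<close> up to an integer.\<close>
  have 1: "((\<lambda>x::real. x powr (- h) * (2 * sqrt 2)) \<longlongrightarrow> 0) at_top"
    using h(1) by real_asymp
  have 2: "((\<lambda>x::real. 2 * sqrt (2 * x powr (2 + 2 * h)) * exp (- (x powr h / 4))) \<longlongrightarrow> 0) at_top"
    using h(1) by real_asymp
  have 3: "((\<lambda>x::real. x * (x powr (- (1 + h / 2)) * (2 + 4 * ln (4 * x * (2 * x powr (2 + 2 * h) + 1) / x powr (- (2 + h)))))) \<longlongrightarrow> 0) at_top"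
    using h(1) by real_asymp
  have "\<forall>\<^sub>F x in at_top. x powr (- h) * (2 * sqrt 2) < e \<and>
      2 * sqrt (2 * x powr (2 + 2 * h)) * exp (- (x powr h / 4)) < e \<and>
      x * (x powr (- (1 + h / 2)) * (2 + 4 * ln (4 * x * (2 * x powr (2 + 2 * h) + 1) / x powr (- (2 + h))))) < e \<and> x \<ge> 1"
    using order_tendstoD(2)[OF 1 e] order_tendstoD(2)[OF 2 e] order_tendstoD(2)[OF 3 e] eventually_ge_at_top[of 1]
    by eventually_elim auto
  then have "\<forall>\<^sub>F k in sequentially. real k powr (- h) * (2 * sqrt 2) < e \<and>
      2 * sqrt (2 * real k powr (2 + 2 * h)) * exp (- (real k powr h / 4)) < e \<and>
      real k * (real k powr (- (1 + h / 2)) * (2 + 4 * ln (4 * real k * (2 * real k powr (2 + 2 * h) + 1) / real k powr (- (2 + h))))) < e \<and> real k \<ge> 1"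
    using filterlim_real_sequentially by (rule eventually_compose_filterlim)
  then obtain K :: nat where K: "real K \<ge> 1"
    and K1: "real K powr (- h) * (2 * sqrt 2) < e"
    and K2: "2 * sqrt (2 * real K powr (2 + 2 * h)) * exp (- (real K powr h / 4)) < e"
    and K3: "real K * (real K powr (- (1 + h / 2)) * (2 + 4 * ln (4 * real K * (2 * real K powr (2 + 2 * h) + 1) / real K powr (- (2 + h))))) < e"
    unfolding eventually_sequentially by blast
  define y where "y = real K powr (2 + 2 * h)"
  define n where "n = nat \<lceil>y\<rceil>"
  define d where "d = real K powr (- (1 + h / 2))"
  have y: "y \<ge> 1" using K h(1) by (simp add: y_def ge_one_powr_ge_zero)
  then have n: "y \<le> n" "n \<le> 2 * y" "n \<ge> 1" unfolding n_def by linarith+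
  have d0: "0 < d" using K by (simp add: d_def)
  have d1: "d \<le> 1"
    using powr_mono[of "- (1 + h / 2)" 0 "real K"] K h(1) by (simp add: d_def)
  have d2: "d\<^sup>2 = real K powr (- (2 + h))"
    using K by (simp add: d_def power2_eq_square powr_add[symmetric])
  have sq: "sqrt n \<le> sqrt (2 * y)" using n(2) by simp
  have "K powr h = y * d\<^sup>2" using K by (simp add: y_def d2 powr_add[symmetric])
  also have "\<dots> \<le> n * d\<^sup>2" using n(1) by (intro mult_right_mono) auto
  finally have yd: "K powr h \<le> n * d\<^sup>2" .
  show ?thesis
  proof (rule that[of K n d])
    have "K powr (1 - p) * (2 * sqrt n) \<le> K powr (1 - p) * (2 * sqrt (2 * y))"
      using sq by (intro mult_left_mono) auto
    also have "\<dots> = K powr (- h) * (2 * sqrt 2)"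
    proof -
      have "y = (K powr (1 + h))\<^sup>2" using K by (simp add: y_def power2_eq_square powr_add[symmetric])
      then have "sqrt (2 * y) = sqrt 2 * K powr (1 + h)" by (simp add: real_sqrt_mult)
      moreover have "K powr (1 - p) * K powr (1 + h) = K powr (- h)"
        using K by (simp add: h(2) powr_add[symmetric])
      ultimately show ?thesis by simp
    qed
    finally show "K powr (1 - p) * (2 * sqrt n) \<le> e" using K1 by simp
    have "2 * sqrt n * exp (- (n * d\<^sup>2 / 4)) \<le> 2 * sqrt (2 * y) * exp (- (K powr h / 4))"
      using sq yd by (intro mult_mono) auto
    then show "2 * sqrt n * exp (- (n * d\<^sup>2 / 4)) \<le> e" using K2 by (simp add: y_def)
    have "4 * real K * (real n + 1) / d\<^sup>2 \<le> 4 * real K * (2 * y + 1) / d\<^sup>2"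
      using n K by (intro divide_right_mono mult_left_mono) auto
    moreover have "0 < 4 * real K * (real n + 1) / d\<^sup>2" using K d0 by (intro divide_pos_pos mult_pos_pos) auto
    ultimately have "ln (4 * real K * (real n + 1) / d\<^sup>2) \<le> ln (4 * real K * (2 * y + 1) / d\<^sup>2)"
      by (intro ln_mono) auto
    then have "K * (d * (2 + 4 * ln (4 * real K * (real n + 1) / d\<^sup>2))) \<le> K * (d * (2 + 4 * ln (4 * real K * (2 * y + 1) / d\<^sup>2)))"
      using K d0 by (intro mult_left_mono) auto
    also have "\<dots> < e" using K3 unfolding d2 unfolding d_def y_def .
    finally show "K * (d * (2 + 4 * ln (4 * real K * (real n + 1) / d\<^sup>2))) < e" .
  qed (use K n d0 d1 in auto)
qed

lemma stage_exists:
  assumes p: "p > 2" and e: "e > 0"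
  shows "\<exists>I T. finite I \<and> (\<forall>(N, d)\<in>I. N \<ge> 1 \<and> 0 < d \<and> d \<le> 1) \<and> (\<Sum>(N, d)\<in>I. cap_cost N d) < e \<and>
    trig_polynomial T \<and> (\<forall>F. finite F \<longrightarrow> (\<Sum>k\<in>F. norm (fourier_coeff T k) powr p) \<le> e) \<and>
    (\<forall>z\<in>circle. (\<forall>(N, d)\<in>I. Re (z ^ N) \<le> cap_height d) \<longrightarrow> norm (T z - 1) \<le> e)"
proof -
  obtain K n :: nat and d :: real where K: "K \<ge> 1" and n: "n \<ge> 1" and d: "0 < d" "d \<le> 1"
    and lp: "K powr (1 - p) * (2 * sqrt n) \<le> e"
    and sup: "2 * sqrt n * exp (- (n * d\<^sup>2 / 4)) \<le> e"
    and cost: "K * (d * (2 + 4 * ln (4 * real K * (real n + 1) / d\<^sup>2))) < e"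
    by (rule parameters_exist[OF p e])
  have "p \<ge> 1" using p by simp
  define M where "M = K * (n + 1)"
  obtain T where T: "trig_polynomial T"
    "\<forall>F. finite F \<longrightarrow> (\<Sum>k\<in>F. norm (fourier_coeff T k) powr p) \<le> K powr (1 - p) * (2 * sqrt n)"
    "\<forall>z\<in>circle. \<forall>d::real. 0 < d \<longrightarrow> d \<le> 1 \<longrightarrow> (\<forall>N\<in>{M..<M + K}. Re (z ^ N) \<le> cap_height d) \<longrightarrow>
      norm (T z - 1) \<le> 2 * sqrt n * exp (- (n * d\<^sup>2 / 4))"
    using flat_polynomial[OF n K \<open>p \<ge> 1\<close>] unfolding M_def by (elim exE conjE)
  have "K \<le> M" using K by (simp add: M_def)
  have "(\<Sum>(N, d)\<in>{M..<M + K} \<times> {d}. cap_cost N d) = (\<Sum>N\<in>{M..<M + K}. cap_cost N d)"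
    by (subst sum.cartesian_product[symmetric]) simp
  also have "\<dots> \<le> (\<Sum>N\<in>{M..<M + K}. d * (2 + 4 * ln (4 * real K * (real n + 1) / d\<^sup>2)))"
  proof (intro sum_mono)
    fix N assume N: "N \<in> {M..<M + K}"
    then have "real N \<le> 2 * real M" "N \<ge> 1" using \<open>K \<le> M\<close> K by auto
    then have "2 * real N / d\<^sup>2 \<le> 4 * real K * (real n + 1) / d\<^sup>2" "0 < 2 * real N / d\<^sup>2"
      using d by (auto simp: M_def distrib_left intro!: divide_right_mono)
    then have "ln (2 * real N / d\<^sup>2) \<le> ln (4 * real K * (real n + 1) / d\<^sup>2)" by (intro ln_mono) auto
    then show "cap_cost N d \<le> d * (2 + 4 * ln (4 * real K * (real n + 1) / d\<^sup>2))"
      unfolding cap_cost_def using d by (intro mult_left_mono) auto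
  qed
  also have "\<dots> < e" using cost by simp
  finally have "(\<Sum>(N, d)\<in>{M..<M + K} \<times> {d}. cap_cost N d) < e" .
  moreover have "\<forall>F. finite F \<longrightarrow> (\<Sum>k\<in>F. norm (fourier_coeff T k) powr p) \<le> e"
    using T(2) lp by (auto intro: order_trans)
  moreover have "norm (T z - 1) \<le> e" if "z \<in> circle" "\<forall>(N, d)\<in>{M..<M + K} \<times> {d}. Re (z ^ N) \<le> cap_height d" for z
  proof -
    have "\<forall>N\<in>{M..<M + K}. Re (z ^ N) \<le> cap_height d" using that(2) by auto
    then have "norm (T z - 1) \<le> 2 * sqrt n * exp (- (n * d\<^sup>2 / 4))"
      using T(3) that(1) d by simp
    then show ?thesis using sup by linarith
  qed
  moreover have "\<forall>(N, d)\<in>{M..<M + K} \<times> {d}. N \<ge> 1 \<and> 0 < d \<and> d \<le> 1"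
    using d K \<open>K \<le> M\<close> by auto
  ultimately show ?thesis using T(1)
    by (intro exI[of _ "{M..<M + K} \<times> {d}"] exI[of _ T]) auto
qed

section \<open>Simultaneous approximation\<close>

text \<open>
  The sum in the extended reals is the supremum of its finite partial sums.
\<close>

lemma lp_dist_powr_le:
  assumes "\<And>F. finite F \<Longrightarrow> (\<Sum>n\<in>F. norm (a n - b n) powr p) \<le> B"
  shows "lp_dist_powr p a b \<le> ennreal B"
  unfolding lp_dist_powr_def
proof (subst nonneg_infsum_complete)
  show "(SUP F\<in>{F. finite F \<and> F \<subseteq> UNIV}. \<Sum>n\<in>F. ennreal (norm (a n - b n) powr p)) \<le> ennreal B"
    using assms by (intro SUP_least) (simp add: sum_ennreal ennreal_leI)
qed simp

lemma norm_diff_less_of_lp_dist_powr_less: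
  assumes "lp_dist_powr p a b < ennreal (e powr p)" "p > 0" "e \<ge> 0"
  shows "norm (a n - b n) < e"
proof -
  have "ennreal (norm (a n - b n) powr p) = (\<Sum>k\<in>{n}. ennreal (norm (a k - b k) powr p))" by simp
  also have "\<dots> \<le> lp_dist_powr p a b"
    unfolding lp_dist_powr_def by (subst nonneg_infsum_complete) (auto intro!: SUP_upper simp del: sum.insert)
  finally have "ennreal (norm (a n - b n) powr p) < ennreal (e powr p)" using assms(1) by simp
  then have "norm (a n - b n) powr p < e powr p" by (simp add: ennreal_less_iff)
  then show ?thesis using powr_mono2[of p e "norm (a n - b n)"] assms(2,3) by linarith
qed

lemma norm_sum_powr_le:
  assumes "finite S" "p \<ge> 0"
  shows "norm (\<Sum>m\<in>S. x m) powr p \<le> real (card S) powr p * (\<Sum>m\<in>S. norm (x m) powr p)"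
proof (cases "S = {}")
  case False
  define M where "M = Max ((\<lambda>m. norm (x m)) ` S)"
  have "M \<in> (\<lambda>m. norm (x m)) ` S" unfolding M_def using assms False by (intro Max_in) auto
  then obtain m where m: "m \<in> S" "M = norm (x m)" by auto
  have "norm (\<Sum>m\<in>S. x m) \<le> (\<Sum>m\<in>S. M)"
    unfolding M_def using assms by (intro sum_norm_le Max_ge) auto
  then have "norm (\<Sum>m\<in>S. x m) powr p \<le> (real (card S) * M) powr p"
    using assms by (intro powr_mono2) auto
  also have "\<dots> = real (card S) powr p * norm (x m) powr p" by (simp add: m powr_mult)
  also have "norm (x m) powr p \<le> (\<Sum>m\<in>S. norm (x m) powr p)"
    using assms m by (intro member_le_sum) auto
  finally show ?thesis by (simp add: mult_left_mono)
qed simp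

lemma norm_add_powr_le:
  assumes "p \<ge> 0"
  shows "norm (x + y) powr p \<le> 2 powr p * (norm x powr p + norm y powr p)"
  using norm_sum_powr_le[of "UNIV :: bool set" p "\<lambda>b. if b then x else y"] assms
  by (simp add: UNIV_bool add.commute)

text \<open>
  The approximant is \<open>s + (h - s) * T\<close>, where \<open>s\<close> is a partial sum of the series with coefficients
  \<open>a\<close>, \<open>h\<close> is uniformly close to \<open>g\<close>, and \<open>T\<close> is flat with a tolerance chosen after \<open>s\<close> and \<open>h\<close>.
  Multiplication by the fixed polynomial \<open>h - s\<close> increases the \<open>\<ell>\<^sup>p\<close> size of the coefficients of
  \<open>T\<close> at most by a constant factor.
\<close>

theorem simultaneous_approximation:
  fixes a :: "int \<Rightarrow> complex" and g :: "complex \<Rightarrow> complex"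
  assumes p: "p \<ge> 1" and E: "E \<subseteq> circle"
    and flat: "\<And>e. e > 0 \<Longrightarrow> \<exists>T. trig_polynomial T \<and>
      (\<forall>F. finite F \<longrightarrow> (\<Sum>k\<in>F. norm (fourier_coeff T k) powr p) \<le> e) \<and> (\<forall>z\<in>E. norm (T z - 1) \<le> e)"
    and a: "(\<lambda>n. norm (a n) powr p) summable_on UNIV"
    and g: "continuous_on circle g" and e: "e > 0"
  shows "\<exists>T. trig_polynomial T \<and> lp_dist_powr p (fourier_coeff T) a \<le> ennreal e \<and> (\<forall>z\<in>E. norm (T z - g z) \<le> e)"
proof -
  \<comment> \<open>The factor \<open>2 powr p\<close> comes from splitting the \<open>p\<close>-th power of a sum of two terms.\<close>
  define e' where "e' = e / (2 * 2 powr p)"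
  have e': "e' > 0" "2 powr p * (e' + e') = e" using e by (auto simp: e'_def)
  obtain S where S: "finite S" "dist (\<Sum>n\<in>S. norm (a n) powr p) (\<Sum>\<^sub>\<infinity>n. norm (a n) powr p) \<le> e'"
    using infsum_finite_approximation[OF a e'(1)] by blast
  have tail: "(\<Sum>n\<in>F - S. norm (a n) powr p) \<le> e'" if "finite F" for F
  proof -
    have "(\<Sum>n\<in>F - S. norm (a n) powr p) + (\<Sum>n\<in>S. norm (a n) powr p) = (\<Sum>n\<in>F \<union> S. norm (a n) powr p)"
      using that S(1) by (subst sum.union_disjoint[symmetric]) (auto simp: Un_commute intro!: sum.cong)
    also have "\<dots> \<le> (\<Sum>\<^sub>\<infinity>n. norm (a n) powr p)"
      using that S(1) by (intro finite_sum_le_infsum a) auto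
    finally show ?thesis using S(2) by (simp add: dist_real_def)
  qed
  define s where "s = (\<lambda>z. \<Sum>n\<in>S. a n * z powi n)"
  have s: "trig_polynomial s" unfolding trig_polynomial_def s_def using S(1) by blast
  have s_coeff: "fourier_coeff s k = (if k \<in> S then a k else 0)" for k
    unfolding s_def by (rule fourier_coeff_sum_powi[OF S(1)])
  obtain h where h: "trig_polynomial h" "\<And>z. z \<in> circle \<Longrightarrow> norm (g z - h z) < e / 2"
    using trig_polynomials_dense[OF g, of "e / 2"] e by auto
  have "trig_polynomial (\<lambda>z. h z + (- 1) * s z)"
    by (intro trig_polynomial_add trig_polynomial_mult trig_polynomial_const h s)
  then obtain R r where R: "finite R" "\<And>z. z \<in> circle \<Longrightarrow> h z + (- 1) * s z = (\<Sum>m\<in>R. r m * z powi m)"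
    unfolding trig_polynomial_def by (elim exE conjE) simp
  define B where "B = (\<Sum>m\<in>R. norm (r m))"
  define C where "C = real (card R) powr p * (\<Sum>m\<in>R. norm (r m) powr p)"
  have BC: "B \<ge> 0" "C \<ge> 0" by (auto simp: B_def C_def intro!: sum_nonneg mult_nonneg_nonneg)
  define d where "d = min (e' / (C + 1)) (e / 2 / (B + 1))"
  have d: "d > 0" "C * d \<le> e'" "B * d \<le> e / 2"
  proof -
    show "d > 0" using e e' BC by (simp add: d_def)
    have "C * d \<le> (C + 1) * (e' / (C + 1))" using BC \<open>d > 0\<close> by (intro mult_mono) (auto simp: d_def)
    then show "C * d \<le> e'" using BC by simp
    have "B * d \<le> (B + 1) * (e / 2 / (B + 1))" using BC \<open>d > 0\<close> by (intro mult_mono) (auto simp: d_def)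
    also have "\<dots> = e / 2"
      by (subst times_divide_eq_right, rule nonzero_mult_div_cancel_left) (use BC in simp)
    finally show "B * d \<le> e / 2" .
  qed
  obtain T where T: "trig_polynomial T" "\<forall>F. finite F \<longrightarrow> (\<Sum>k\<in>F. norm (fourier_coeff T k) powr p) \<le> d"
    "\<forall>z\<in>E. norm (T z - 1) \<le> d"
    using flat[OF d(1)] by (elim exE conjE)
  define U where "U = (\<lambda>z. s z + (\<Sum>m\<in>R. r m * z powi m) * T z)"
  have rpoly: "trig_polynomial (\<lambda>z. \<Sum>m\<in>R. r m * z powi m)"
    unfolding trig_polynomial_def using R(1) by blast
  show ?thesis
  proof (intro exI[of _ U] conjI ballI)
    show "trig_polynomial U"
      unfolding U_def by (intro trig_polynomial_add trig_polynomial_mult s T(1) rpoly)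
    show "lp_dist_powr p (fourier_coeff U) a \<le> ennreal e"
    proof (rule lp_dist_powr_le)
      fix F :: "int set" assume F: "finite F"
      define t where "t k = (\<Sum>m\<in>R. r m * fourier_coeff T (k - m))" for k
      have coeff: "fourier_coeff U k = fourier_coeff s k + t k" for k
      proof -
        have "fourier_coeff U k = fourier_coeff s k + fourier_coeff (\<lambda>z. (\<Sum>m\<in>R. r m * z powi m) * T z) k"
          unfolding U_def
          by (rule fourier_coeff_add) (intro continuous_on_trig_polynomial trig_polynomial_mult s rpoly T(1))+
        then show ?thesis
          unfolding t_def using fourier_coeff_sum_powi_mult[OF R(1) continuous_on_trig_polynomial[OF T(1)]] by simp
      qed
      have "(\<Sum>k\<in>F. norm (fourier_coeff U k - a k) powr p) \<le>
          (\<Sum>k\<in>F. 2 powr p * (norm (fourier_coeff s k - a k) powr p + norm (t k) powr p))"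
      proof (intro sum_mono)
        fix k
        have eq: "fourier_coeff U k - a k = (fourier_coeff s k - a k) + t k" by (simp add: coeff)
        show "norm (fourier_coeff U k - a k) powr p \<le>
            2 powr p * (norm (fourier_coeff s k - a k) powr p + norm (t k) powr p)"
          unfolding eq by (rule norm_add_powr_le) (use p in simp)
      qed
      also have "\<dots> = 2 powr p * ((\<Sum>k\<in>F. norm (fourier_coeff s k - a k) powr p) + (\<Sum>k\<in>F. norm (t k) powr p))"
        by (simp only: sum.distrib sum_distrib_left[symmetric])
      also have "\<dots> \<le> 2 powr p * (e' + e')"
      proof (intro mult_left_mono add_mono)
        have "(\<Sum>k\<in>F. norm (fourier_coeff s k - a k) powr p) = (\<Sum>k\<in>F - S. norm (a k) powr p)"
          using F by (intro sum.mono_neutral_cong_right) (auto simp: s_coeff)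
        then show "(\<Sum>k\<in>F. norm (fourier_coeff s k - a k) powr p) \<le> e'" using tail[OF F] by simp
        have "(\<Sum>k\<in>F. norm (t k) powr p) \<le>
            (\<Sum>k\<in>F. real (card R) powr p * (\<Sum>m\<in>R. norm (r m * fourier_coeff T (k - m)) powr p))"
          unfolding t_def using R(1) p by (intro sum_mono norm_sum_powr_le) auto
        also have "\<dots> = real (card R) powr p *
            (\<Sum>m\<in>R. norm (r m) powr p * (\<Sum>k\<in>F. norm (fourier_coeff T (k - m)) powr p))"
          by (simp add: sum_distrib_left norm_mult powr_mult) (subst sum.swap, simp)
        also have "\<dots> \<le> real (card R) powr p * (\<Sum>m\<in>R. norm (r m) powr p * d)"
        proof (intro mult_left_mono sum_mono)
          fix m
          have "(\<Sum>k\<in>F. norm (fourier_coeff T (k - m)) powr p) =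
              (\<Sum>k\<in>(\<lambda>k. k - m) ` F. norm (fourier_coeff T k) powr p)"
            by (subst sum.reindex) (auto simp: inj_on_def)
          also have "\<dots> \<le> d" using T(2) F by simp
          finally show "(\<Sum>k\<in>F. norm (fourier_coeff T (k - m)) powr p) \<le> d" .
        qed auto
        also have "\<dots> = C * d" by (simp add: C_def sum_distrib_right)
        finally show "(\<Sum>k\<in>F. norm (t k) powr p) \<le> e'" using d(2) by simp
      qed simp
      finally show "(\<Sum>k\<in>F. norm (fourier_coeff U k - a k) powr p) \<le> e" using e'(2) by simp
    qed
    fix z assume z: "z \<in> E"
    then have zc: "z \<in> circle" using E by blast
    then have "norm z = 1" by simp
    define \<rho> where "\<rho> = (\<Sum>m\<in>R. r m * z powi m)"
    have eq: "U z - g z = (h z - g z) + \<rho> * (T z - 1)"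
      using R(2)[OF zc] by (simp add: U_def \<rho>_def algebra_simps)
    have "norm (U z - g z) \<le> norm (h z - g z) + norm \<rho> * norm (T z - 1)"
      unfolding eq norm_mult[symmetric] by (rule norm_triangle_ineq)
    also have "\<dots> \<le> e / 2 + B * d"
    proof (intro add_mono mult_mono)
      show "norm (h z - g z) \<le> e / 2" using h(2)[OF zc] by (simp add: norm_minus_commute)
      show "norm \<rho> \<le> B"
        unfolding \<rho>_def B_def using \<open>norm z = 1\<close>
        by (intro sum_norm_le) (simp add: norm_mult norm_power_int)
    qed (use T(3) z BC in auto)
    finally show "norm (U z - g z) \<le> e" using d(3) by simp
  qed
qed

section \<open>Analytic polynomials that are small on the set\<close>

lemma sum_Union_le:
  fixes f :: "'a \<Rightarrow> real" and A :: "nat \<Rightarrow> 'a set"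
  assumes "\<And>k. k < n \<Longrightarrow> finite (A k)" "\<And>k x. k < n \<Longrightarrow> x \<in> A k \<Longrightarrow> 0 \<le> f x"
  shows "sum f (\<Union>k<n. A k) \<le> (\<Sum>k<n. sum f (A k))"
  using assms
proof (induction n)
  case (Suc n)
  have "sum f ((\<Union>k<n. A k) \<union> A n) + sum f ((\<Union>k<n. A k) \<inter> A n) = sum f (\<Union>k<n. A k) + sum f (A n)"
    using Suc.prems(1) by (intro sum.union_inter) auto
  moreover have "0 \<le> sum f ((\<Union>k<n. A k) \<inter> A n)"
    using Suc.prems(2)[of n] by (intro sum_nonneg) auto
  ultimately have "sum f ((\<Union>k<n. A k) \<union> A n) \<le> sum f (\<Union>k<n. A k) + sum f (A n)" by linarith
  also have "sum f (\<Union>k<n. A k) \<le> (\<Sum>k<n. sum f (A k))"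
    using Suc.prems by (intro Suc.IH) (meson less_Suc_eq)+
  finally show ?case by (simp add: lessThan_Suc Un_commute)
qed simp

text \<open>
  Any stages of total cost at most \<open>1 / 4\<close> produce a set that has the uniqueness property.
\<close>

context
  fixes I :: "nat \<Rightarrow> (nat \<times> real) set" and E :: "complex set"
  assumes I_fin: "\<And>k. finite (I k)"
    and I: "\<And>k N d. (N, d) \<in> I k \<Longrightarrow> N \<ge> 1 \<and> 0 < d \<and> d \<le> 1"
    and cost: "\<And>n. (\<Sum>k<n. \<Sum>(N, d)\<in>I k. cap_cost N d) \<le> 1 / 4"
    and E_eq: "E = {z \<in> circle. \<forall>k. \<forall>(N, d)\<in>I k. Re (z ^ N) \<le> cap_height d}"
begin

lemma compact_stage: "compact {z \<in> circle. \<forall>k<n. \<forall>(N, d)\<in>I k. Re (z ^ N) \<le> cap_height d}"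
proof -
  have "{z \<in> circle. \<forall>k<n. \<forall>(N, d)\<in>I k. Re (z ^ N) \<le> cap_height d} =
      circle \<inter> (\<Inter>k\<in>{..<n}. \<Inter>(N, d)\<in>I k. {z. Re (z ^ N) \<le> cap_height d})" by auto
  moreover have "closed {z :: complex. Re (z ^ N) \<le> cap_height d}" for N d
    by (intro closed_Collect_le continuous_intros)
  ultimately show ?thesis by (auto intro!: compact_Int_closed closed_INT)
qed

lemma compact_E: "compact E"
proof -
  have "E = circle \<inter> (\<Inter>k. \<Inter>(N, d)\<in>I k. {z. Re (z ^ N) \<le> cap_height d})" unfolding E_eq by auto
  moreover have "closed {z :: complex. Re (z ^ N) \<le> cap_height d}" for N d
    by (intro closed_Collect_le continuous_intros)
  ultimately show ?thesis by (auto intro!: compact_Int_closed closed_INT)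
qed

text \<open>
  The bound for finitely many arc families carries over to \<open>E\<close>: by compactness, a polynomial that is
  at most \<open>\<eta>\<close> on \<open>E\<close> is below \<open>2 * \<eta>\<close> on what is left of the circle after finitely many stages.
\<close>

lemma constant_coefficient_small:
  fixes q :: "complex poly"
  assumes C: "1 \<le> C" "\<And>n. norm (coeff q n) \<le> C"
    and eta: "0 < \<eta>" "2 * \<eta> \<le> 1" and small: "\<And>z. z \<in> E \<Longrightarrow> norm (poly q z) \<le> \<eta>"
  shows "norm (coeff q 0) \<le> C * exp 1 * sqrt (2 * \<eta>)"
proof -
  have "\<exists>n. \<forall>z\<in>circle. (\<forall>k<n. \<forall>(N, d)\<in>I k. Re (z ^ N) \<le> cap_height d) \<longrightarrow> norm (poly q z) < 2 * \<eta>"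
  proof (rule ccontr)
    define F where "F n = {z \<in> circle. \<forall>k<n. \<forall>(N, d)\<in>I k. Re (z ^ N) \<le> cap_height d} \<inter> {z. 2 * \<eta> \<le> norm (poly q z)}" for n
    assume none: "\<nexists>n. \<forall>z\<in>circle. (\<forall>k<n. \<forall>(N, d)\<in>I k. Re (z ^ N) \<le> cap_height d) \<longrightarrow> norm (poly q z) < 2 * \<eta>"
    have "F n \<noteq> {}" for n
    proof -
      obtain z where "z \<in> circle" "\<forall>k<n. \<forall>(N, d)\<in>I k. Re (z ^ N) \<le> cap_height d" "\<not> norm (poly q z) < 2 * \<eta>"
        using none by blast
      then have "z \<in> F n" unfolding F_def by (intro IntI CollectI conjI) (simp_all only: not_less)
      then show ?thesis by blast
    qed
    moreover have "closed {z. 2 * \<eta> \<le> norm (poly q z)}"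
      by (intro closed_Collect_le continuous_intros)
    then have "compact (F n)" for n unfolding F_def by (intro compact_Int_closed compact_stage)
    moreover have "F n \<subseteq> F m" if "m \<le> n" for m n
    proof -
      have "k < n" if "k < m" for k using that \<open>m \<le> n\<close> by simp
      then show ?thesis unfolding F_def by blast
    qed
    ultimately have "\<Inter>(range F) \<noteq> {}" by (intro compact_nest)
    then obtain z where z: "z \<in> F n" for n by blast
    have "z \<in> circle" using z[of 0] by (simp add: F_def)
    moreover have "\<forall>k. \<forall>(N, d)\<in>I k. Re (z ^ N) \<le> cap_height d"
    proof
      fix k
      have "\<forall>j<Suc k. \<forall>(N, d)\<in>I j. Re (z ^ N) \<le> cap_height d"
        using z[of "Suc k"] unfolding F_def by (elim IntE CollectE conjE)
      then show "\<forall>(N, d)\<in>I k. Re (z ^ N) \<le> cap_height d" by (elim allE impE) (rule lessI)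
    qed
    ultimately have "norm (poly q z) \<le> \<eta>" by (intro small) (simp add: E_eq)
    moreover have "2 * \<eta> \<le> norm (poly q z)" using z[of 0] by (simp add: F_def)
    ultimately show False using eta by simp
  qed
  then obtain n where n: "\<And>z. z \<in> circle \<Longrightarrow> \<forall>k<n. \<forall>(N, d)\<in>I k. Re (z ^ N) \<le> cap_height d \<Longrightarrow> norm (poly q z) < 2 * \<eta>"
    by blast
  have "norm (poly q 0) \<le> C * exp 1 * sqrt (2 * \<eta>)"
  proof (rule constant_coefficient_bound[where I = "\<Union>k<n. I k"])
    show "finite (\<Union>k<n. I k)" using I_fin by simp
    show "1 \<le> N \<and> 0 < d \<and> d \<le> 1" if "(N, d) \<in> (\<Union>k<n. I k)" for N d using that I by auto
    show "poly q holomorphic_on UNIV" by (intro holomorphic_intros)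
    show "norm (poly q z) \<le> C / (1 - norm z)" if z: "norm z < 1" for z
    proof -
      have "norm (poly q z) \<le> (\<Sum>i\<le>degree q. norm (coeff q i * z ^ i))"
        unfolding poly_altdef by (rule norm_sum)
      also have "\<dots> \<le> (\<Sum>i\<le>degree q. C * norm z ^ i)"
        using C by (intro sum_mono) (simp add: norm_mult norm_power mult_right_mono)
      also have "\<dots> = C * (\<Sum>i\<le>degree q. norm z ^ i)" by (simp add: sum_distrib_left)
      also have "\<dots> \<le> C * (1 / (1 - norm z))"
      proof (intro mult_left_mono)
        have "(\<Sum>i\<le>degree q. norm z ^ i) \<le> (\<Sum>i. norm z ^ i)"
          using z by (intro sum_le_suminf summable_geometric) auto
        then show "(\<Sum>i\<le>degree q. norm z ^ i) \<le> 1 / (1 - norm z)" using z by (simp add: suminf_geometric)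
      qed (use C in simp)
      finally show ?thesis by simp
    qed
    show "norm (poly q z) \<le> 2 * \<eta>"
      if "norm z = 1" "\<forall>(N, d)\<in>\<Union>k<n. I k. Re (z ^ N) \<le> cap_height d" for z
      using n[of z] that by force
    have "(\<Sum>(N, d)\<in>(\<Union>k<n. I k). cap_cost N d) \<le> (\<Sum>k<n. \<Sum>(N, d)\<in>I k. cap_cost N d)"
    proof (rule sum_Union_le)
      fix k x assume x: "x \<in> I k"
      obtain N d where "x = (N, d)" by (cases x)
      then show "0 \<le> (case x of (N, d) \<Rightarrow> cap_cost N d)"
        using I[of N d k] cap_cost_ge(2)[of d N] x by simp
    qed (rule I_fin)
    then show "(\<Sum>(N, d)\<in>(\<Union>k<n. I k). cap_cost N d) \<le> 1 / 4" using cost[of n] by simp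
  qed (use C eta in auto)
  then show ?thesis by (simp add: poly_0_coeff_0)
qed

lemma constant_coefficients_tendsto_0:
  fixes q :: "nat \<Rightarrow> complex poly"
  assumes C: "1 \<le> C" "\<forall>\<^sub>F N in sequentially. \<forall>n. norm (coeff (q N) n) \<le> C"
    and small: "\<And>\<eta>. \<eta> > 0 \<Longrightarrow> \<forall>\<^sub>F N in sequentially. \<forall>z\<in>E. norm (poly (q N) z) \<le> \<eta>"
  shows "(\<lambda>N. coeff (q N) 0) \<longlonglongrightarrow> 0"
proof (rule tendstoI)
  fix e :: real assume e: "e > 0"
  \<comment> \<open>With this \<open>\<eta>\<close> the bound \<open>C * exp 1 * sqrt (2 * \<eta>)\<close> is at most \<open>e / 2\<close>.\<close>
  define \<eta> where "\<eta> = min (1 / 2) ((e / (2 * C * exp 1))\<^sup>2 / 2)"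
  have eta: "\<eta> > 0" "2 * \<eta> \<le> 1" using e C(1) by (auto simp: \<eta>_def)
  have "sqrt (2 * \<eta>) \<le> sqrt ((e / (2 * C * exp 1))\<^sup>2)"
    unfolding real_sqrt_le_iff by (auto simp: \<eta>_def)
  also have "\<dots> = e / (2 * C * exp 1)" using e C(1) by simp
  finally have "C * exp 1 * sqrt (2 * \<eta>) \<le> C * exp 1 * (e / (2 * C * exp 1))"
    using C(1) by (intro mult_left_mono) auto
  also have "\<dots> < e" using e C(1) by simp
  finally have lt: "C * exp 1 * sqrt (2 * \<eta>) < e" .
  show "\<forall>\<^sub>F N in sequentially. dist (coeff (q N) 0) 0 < e"
    using C(2) small[OF eta(1)]
  proof eventually_elim
    case (elim N)
    then have "norm (coeff (q N) 0) \<le> C * exp 1 * sqrt (2 * \<eta>)"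
      using C(1) eta by (intro constant_coefficient_small) auto
    then show ?case using lt by simp
  qed
qed

text \<open>
  Once the constant coefficients tend to \<open>0\<close>, the quotients \<open>(Q - Q 0) / z\<close> satisfy the same
  hypotheses: division by \<open>z\<close> does not change the modulus on the circle and only shifts the
  coefficients.
\<close>

lemma coefficients_tendsto_0:
  fixes q :: "nat \<Rightarrow> complex poly"
  assumes C: "1 \<le> C" "\<forall>\<^sub>F N in sequentially. \<forall>n. norm (coeff (q N) n) \<le> C"
    and small: "\<And>\<eta>. \<eta> > 0 \<Longrightarrow> \<forall>\<^sub>F N in sequentially. \<forall>z\<in>E. norm (poly (q N) z) \<le> \<eta>"
  shows "(\<lambda>N. coeff (q N) n) \<longlonglongrightarrow> 0"
  using assms(2,3)
proof (induction n arbitrary: q)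
  case 0
  then show ?case by (intro constant_coefficients_tendsto_0[OF C(1)])
next
  case (Suc n)
  have lim0: "(\<lambda>N. coeff (q N) 0) \<longlonglongrightarrow> 0"
    using Suc.prems by (intro constant_coefficients_tendsto_0[OF C(1)])
  \<comment> \<open>\<open>poly_shift 1\<close> is the map from \<open>Q\<close> to \<open>(Q - Q 0) / z\<close>.\<close>
  define r where "r N = poly_shift 1 (q N)" for N
  have q_eq: "q N = pCons (coeff (q N) 0) (r N)" for N
    by (rule poly_eqI) (simp add: r_def coeff_pCons coeff_poly_shift split: nat.split)
  have "(\<lambda>N. coeff (r N) n) \<longlonglongrightarrow> 0"
  proof (rule Suc.IH)
    show "\<forall>\<^sub>F N in sequentially. \<forall>n. norm (coeff (r N) n) \<le> C"
      using Suc.prems(1) by eventually_elim (simp add: r_def coeff_poly_shift)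
    fix \<eta> :: real assume eta: "\<eta> > 0"
    have "\<forall>\<^sub>F N in sequentially. norm (coeff (q N) 0) < \<eta> / 2"
      using tendstoD[OF lim0, of "\<eta> / 2"] eta by simp
    moreover have "\<forall>\<^sub>F N in sequentially. \<forall>z\<in>E. norm (poly (q N) z) \<le> \<eta> / 2"
      using Suc.prems(2)[of "\<eta> / 2"] eta by simp
    ultimately show "\<forall>\<^sub>F N in sequentially. \<forall>z\<in>E. norm (poly (r N) z) \<le> \<eta>"
    proof eventually_elim
      case (elim N)
      show ?case
      proof
        fix z assume z: "z \<in> E"
        then have "norm z = 1" by (simp add: E_eq)
        have "poly (q N) z = coeff (q N) 0 + z * poly (r N) z"
          by (subst q_eq) simp
        then have "z * poly (r N) z = poly (q N) z - coeff (q N) 0" by simp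
        then have "norm (poly (r N) z) = norm (poly (q N) z - coeff (q N) 0)"
          using \<open>norm z = 1\<close> norm_mult[of z "poly (r N) z"] by simp
        also have "\<dots> \<le> norm (poly (q N) z) + norm (coeff (q N) 0)" by (rule norm_triangle_ineq4)
        also have "\<dots> \<le> \<eta>" using elim z by force
        finally show "norm (poly (r N) z) \<le> \<eta>" .
      qed
    qed
  qed
  then show ?case by (simp add: r_def coeff_poly_shift)
qed

end

lemma analytic_polynomial_poly:
  assumes "analytic_polynomial Q"
  obtains q :: "complex poly" where "\<And>z. z \<in> circle \<Longrightarrow> Q z = poly q z"
    "\<And>n. fourier_coeff Q (int n) = coeff q n"
proof -
  obtain S c where S: "finite S" "\<And>z. z \<in> circle \<Longrightarrow> Q z = (\<Sum>n\<in>S. c n * z ^ n)"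
    using assms unfolding analytic_polynomial_def by blast
  define q where "q = (\<Sum>n\<in>S. monom (c n) n)"
  show ?thesis
  proof (rule that[of q])
    show "Q z = poly q z" if "z \<in> circle" for z
      using S(2)[OF that] by (simp add: q_def poly_sum poly_monom)
    show "fourier_coeff Q (int n) = coeff q n" for n
    proof -
      have "fourier_coeff Q (int n) = fourier_coeff (\<lambda>z. \<Sum>k\<in>int ` S. c (nat k) * z powi k) (int n)"
        using S(2) by (intro fourier_coeff_cong) (simp add: sum.reindex inj_on_def)
      also have "\<dots> = (if n \<in> S then c n else 0)"
        using S(1) by (subst fourier_coeff_sum_powi) auto
      also have "\<dots> = coeff q n" using S(1) by (simp add: q_def coeff_sum)
      finally show ?thesis .
    qed
  qed
qed

section \<open>The compact set\<close>

lemma norm_fourier_coeff_le: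
  "norm (fourier_coeff f n) \<le> (LINT z|circle_measure. norm (f z))"
proof -
  have "norm (fourier_coeff f n) \<le> (LINT z|circle_measure. norm (f z * z powi (- n)))"
    unfolding fourier_coeff_def by (rule integral_norm_bound)
  also have "\<dots> = (LINT z|circle_measure. norm (f z))"
    by (intro Bochner_Integration.integral_cong) (auto simp: space_circle_measure norm_mult norm_power_int)
  finally show ?thesis .
qed

lemma integrable_H2:
  assumes "f \<in> H2"
  shows "integrable circle_measure f"
proof -
  have f: "f \<in> borel_measurable circle_measure" "integrable circle_measure (\<lambda>z. (norm (f z))\<^sup>2)"
    using assms by (auto simp: H2_def)
  have "integrable circle_measure (\<lambda>z. norm (f z))"
    by (rule circle.square_integrable_imp_integrable) (use f in auto)
  then show ?thesis using f(1) by (simp add: integrable_norm_iff)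
qed

lemma bdd_above_norm_image:
  fixes f :: "complex \<Rightarrow> complex"
  assumes "compact E" "continuous_on E f"
  shows "bdd_above ((\<lambda>z. norm (f z)) ` E)"
  using assms by (intro bounded_imp_bdd_above compact_imp_bounded compact_continuous_image continuous_on_norm)

text \<open>
  The measure of the arcs of \<open>(N, d)\<close> is at most \<open>8 * d\<close>, and \<open>2 * d\<close> is a lower bound for the cost.
\<close>

lemma measure_stages:
  fixes I :: "nat \<Rightarrow> (nat \<times> real) set"
  assumes I_fin: "\<And>k. finite (I k)"
    and I: "\<And>k N d. (N, d) \<in> I k \<Longrightarrow> N \<ge> 1 \<and> 0 < d \<and> d \<le> 1"
    and cost: "\<And>k. (\<Sum>(N, d)\<in>I k. cap_cost N d) \<le> c k" and c: "summable c"
  shows "measure circle_measure {z \<in> circle. \<forall>k. \<forall>(N, d)\<in>I k. Re (z ^ N) \<le> cap_height d} \<ge> 1 - 4 * suminf c"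
proof -
  define A where "A = (\<lambda>(N, d). {z \<in> circle. cap_height d < Re (z ^ N)})"
  define U where "U k = (\<Union>x\<in>I k. A x)" for k
  have A: "A x \<in> sets circle_measure" "measure circle_measure (A x) \<le> 4 * (case x of (N, d) \<Rightarrow> cap_cost N d)"
    if x: "x \<in> I k" for x k
  proof -
    obtain N d where Nd: "x = (N, d)" by (cases x)
    then have "0 < d" "d \<le> 1" "N \<ge> 1" using I[of N d k] x by auto
    then show "A x \<in> sets circle_measure" "measure circle_measure (A x) \<le> 4 * (case x of (N, d) \<Rightarrow> cap_cost N d)"
      using measure_cap_le[of d N] cap_cost_ge(2)[of d N] by (auto simp: A_def Nd)
  qed
  have U: "U k \<in> sets circle_measure" for k unfolding U_def using I_fin A by (intro sets.finite_UN) auto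
  have mU: "measure circle_measure (U k) \<le> 4 * c k" for k
  proof -
    have "measure circle_measure (U k) \<le> (\<Sum>x\<in>I k. measure circle_measure (A x))"
      unfolding U_def using I_fin A by (intro circle.finite_measure_subadditive_finite) auto
    also have "\<dots> \<le> (\<Sum>x\<in>I k. 4 * (case x of (N, d) \<Rightarrow> cap_cost N d))" by (intro sum_mono A)
    also have "\<dots> \<le> 4 * c k" using cost[of k] by (simp add: sum_distrib_left[symmetric])
    finally show ?thesis .
  qed
  have c4: "summable (\<lambda>k. 4 * c k)" using c by (rule summable_mult)
  have sumU: "summable (\<lambda>k. measure circle_measure (U k))"
    using mU by (intro summable_comparison_test'[OF c4]) simp
  have "measure circle_measure (\<Union>k. U k) \<le> (\<Sum>k. measure circle_measure (U k))"
    using U sumU by (intro circle.finite_measure_subadditive_countably) auto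
  also have "\<dots> \<le> (\<Sum>k. 4 * c k)" using mU sumU c4 by (intro suminf_le) auto
  also have "\<dots> = 4 * suminf c" using c by (rule suminf_mult)
  finally have le: "measure circle_measure (\<Union>k. U k) \<le> 4 * suminf c" .
  have eq: "{z \<in> circle. \<forall>k. \<forall>(N, d)\<in>I k. Re (z ^ N) \<le> cap_height d} = space circle_measure - (\<Union>k. U k)"
    by (auto simp: U_def A_def space_circle_measure Ball_def linorder_not_less[symmetric])
  have "(\<Union>k. U k) \<in> sets circle_measure" using U by auto
  then have "measure circle_measure (space circle_measure - (\<Union>k. U k)) = 1 - measure circle_measure (\<Union>k. U k)"
    by (subst circle.finite_measure_compl) (auto simp: space_circle_measure measure_circle)
  then show ?thesis unfolding eq using le by simp
qed

theorem corollary1p4: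
  fixes p \<epsilon> :: real
  assumes "p > 2" and "0 < \<epsilon>" and "\<epsilon> < 1"
  shows "\<exists>E. compact E \<and> E \<subseteq> circle \<and> measure circle_measure E > 1 - \<epsilon> \<and>
    (\<forall>f g. f \<in> A_space p \<longrightarrow> continuous_on circle g \<longrightarrow>
      (\<exists>T :: nat \<Rightarrow> complex \<Rightarrow> complex. (\<forall>N. trig_polynomial (T N)) \<and>
        (\<lambda>N. lp_dist_powr p (fourier_coeff (T N)) (distribution_coeff f)) \<longlonglongrightarrow> 0 \<and>
        (\<lambda>N. SUP z\<in>E. norm (T N z - g z :: complex)) \<longlonglongrightarrow> 0)) \<and>
    (\<forall>(Q :: nat \<Rightarrow> complex \<Rightarrow> complex) f. (\<forall>N. analytic_polynomial (Q N)) \<longrightarrow> f \<in> H2 \<longrightarrow>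
        (\<lambda>N. lp_dist_powr p (fourier_coeff (Q N)) (fourier_coeff f)) \<longlonglongrightarrow> 0 \<longrightarrow>
        (\<lambda>N. SUP z\<in>E. norm (Q N z)) \<longlonglongrightarrow> 0 \<longrightarrow>
        (AE z in circle_measure. f z = 0))"
proof -
  \<comment> \<open>The total cost is at most \<open>\<epsilon> / 8\<close>, so that the removed arcs have measure at most \<open>\<epsilon> / 2\<close>.\<close>
  define c where "c k = \<epsilon> / 16 * (1 / 2) ^ k" for k :: nat
  have c_pos: "c k > 0" for k using assms by (simp add: c_def)
  have c_sums: "c sums (\<epsilon> / 8)"
    using sums_mult[OF geometric_sums[of "1 / 2 :: real"], of "\<epsilon> / 16"] by (simp add: c_def [abs_def])
  have "\<forall>k. \<exists>I T. finite I \<and> (\<forall>(N, d)\<in>I. N \<ge> 1 \<and> 0 < d \<and> d \<le> 1) \<and> (\<Sum>(N, d)\<in>I. cap_cost N d) < c k \<and>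
    trig_polynomial T \<and> (\<forall>F. finite F \<longrightarrow> (\<Sum>k\<in>F. norm (fourier_coeff T k) powr p) \<le> c k) \<and>
    (\<forall>z\<in>circle. (\<forall>(N, d)\<in>I. Re (z ^ N) \<le> cap_height d) \<longrightarrow> norm (T z - 1) \<le> c k)"
    using stage_exists[OF assms(1) c_pos] by (intro allI)
  then obtain I T where IT_all: "\<forall>k. finite (I k) \<and> (\<forall>(N, d)\<in>I k. N \<ge> 1 \<and> 0 < d \<and> d \<le> 1) \<and>
    (\<Sum>(N, d)\<in>I k. cap_cost N d) < c k \<and> trig_polynomial (T k) \<and>
    (\<forall>F. finite F \<longrightarrow> (\<Sum>j\<in>F. norm (fourier_coeff (T k) j) powr p) \<le> c k) \<and>
    (\<forall>z\<in>circle. (\<forall>(N, d)\<in>I k. Re (z ^ N) \<le> cap_height d) \<longrightarrow> norm (T k z - 1) \<le> c k)"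
    unfolding choice_iff by (elim exE)
  note IT = spec[OF IT_all]
  have I_fin: "finite (I k)" for k using IT[of k] by simp
  have I: "N \<ge> 1 \<and> 0 < d \<and> d \<le> 1" if "(N, d) \<in> I k" for k N d using IT[of k] that by auto
  have cost: "(\<Sum>(N, d)\<in>I k. cap_cost N d) \<le> c k" for k using IT[of k] by simp
  have costs: "(\<Sum>k<n. \<Sum>(N, d)\<in>I k. cap_cost N d) \<le> 1 / 4" for n
  proof -
    have "(\<Sum>k<n. \<Sum>(N, d)\<in>I k. cap_cost N d) \<le> (\<Sum>k<n. c k)" by (intro sum_mono cost)
    also have "\<dots> \<le> \<epsilon> / 8"
      using c_sums c_pos sum_le_suminf[OF sums_summable[OF c_sums], of "{..<n}"]
      by (simp add: sums_iff less_imp_le)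
    finally show ?thesis using assms by simp
  qed
  define E where "E = {z \<in> circle. \<forall>k. \<forall>(N, d)\<in>I k. Re (z ^ N) \<le> cap_height d}"
  note stages = I_fin I costs E_def
  have E: "compact E" by (rule compact_E[OF stages])
  have Esub: "E \<subseteq> circle" by (auto simp: E_def)
  have "measure circle_measure E \<ge> 1 - 4 * suminf c"
    unfolding E_def by (rule measure_stages[OF I_fin I cost sums_summable[OF c_sums]])
  moreover have "suminf c = \<epsilon> / 8" using c_sums by (simp add: sums_iff)
  ultimately have mE: "measure circle_measure E > 1 - \<epsilon>" using assms by simp
  then have "E \<noteq> {}" using assms by auto
  have flat: "\<exists>T. trig_polynomial T \<and> (\<forall>F. finite F \<longrightarrow> (\<Sum>k\<in>F. norm (fourier_coeff T k) powr p) \<le> e) \<and>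
      (\<forall>z\<in>E. norm (T z - 1) \<le> e)" if "e > 0" for e
  proof -
    have "c \<longlonglongrightarrow> 0" by (rule summable_LIMSEQ_zero[OF sums_summable[OF c_sums]])
    then have "\<forall>\<^sub>F k in sequentially. c k < e" using that by (rule order_tendstoD(2))
    then obtain k where k: "c k < e" by (auto simp: eventually_sequentially)
    have "norm (T k z - 1) \<le> e" if "z \<in> E" for z
    proof -
      have "z \<in> circle" "\<forall>(N, d)\<in>I k. Re (z ^ N) \<le> cap_height d"
        using that unfolding E_def by blast+
      then have "norm (T k z - 1) \<le> c k" using IT[of k] by simp
      then show ?thesis using k by simp
    qed
    moreover have "(\<Sum>j\<in>F. norm (fourier_coeff (T k) j) powr p) \<le> e" if "finite F" for F
    proof -
      have "(\<Sum>j\<in>F. norm (fourier_coeff (T k) j) powr p) \<le> c k" using IT[of k] that by simp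
      then show ?thesis using k by simp
    qed
    ultimately show ?thesis using IT[of k] by (intro exI[of _ "T k"]) simp
  qed
  show ?thesis
  proof (intro exI[of _ E] conjI allI impI)
    show "compact E" "E \<subseteq> circle" "measure circle_measure E > 1 - \<epsilon>" by fact+
  next
    fix f and g :: "complex \<Rightarrow> complex"
    assume f: "f \<in> A_space p" and g: "continuous_on circle g"
    have summ: "(\<lambda>n. norm (distribution_coeff f n) powr p) summable_on UNIV" using f by (simp add: A_space_def)
    have "\<exists>T. trig_polynomial T \<and> lp_dist_powr p (fourier_coeff T) (distribution_coeff f) \<le> ennreal e \<and>
        (\<forall>z\<in>E. norm (T z - g z) \<le> e)" if "e > 0" for e
      using assms(1) by (intro simultaneous_approximation flat Esub summ g that) auto
    then have "\<forall>N. \<exists>T. trig_polynomial T \<and>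
        lp_dist_powr p (fourier_coeff T) (distribution_coeff f) \<le> ennreal (inverse (real (Suc N))) \<and>
        (\<forall>z\<in>E. norm (T z - g z) \<le> inverse (real (Suc N)))" by simp
    then obtain R where R_all: "\<forall>N. trig_polynomial (R N) \<and>
        lp_dist_powr p (fourier_coeff (R N)) (distribution_coeff f) \<le> ennreal (inverse (real (Suc N))) \<and>
        (\<forall>z\<in>E. norm (R N z - g z) \<le> inverse (real (Suc N)))"
      unfolding choice_iff by (elim exE)
    note R = spec[OF R_all]
    show "\<exists>T :: nat \<Rightarrow> complex \<Rightarrow> complex. (\<forall>N. trig_polynomial (T N)) \<and>
        (\<lambda>N. lp_dist_powr p (fourier_coeff (T N)) (distribution_coeff f)) \<longlonglongrightarrow> 0 \<and>
        (\<lambda>N. SUP z\<in>E. norm (T N z - g z :: complex)) \<longlonglongrightarrow> 0"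
    proof (intro exI[of _ R] conjI allI)
      show "trig_polynomial (R N)" for N using R by simp
      show "(\<lambda>N. lp_dist_powr p (fourier_coeff (R N)) (distribution_coeff f)) \<longlonglongrightarrow> 0"
      proof (rule tendsto_sandwich[OF _ _ tendsto_const])
        show "(\<lambda>N. ennreal (inverse (real (Suc N)))) \<longlonglongrightarrow> 0"
          using LIMSEQ_inverse_real_of_nat by (subst ennreal_tendsto_0_iff) auto
      qed (use R in auto)
      show "(\<lambda>N. SUP z\<in>E. norm (R N z - g z)) \<longlonglongrightarrow> 0"
      proof (rule tendsto_sandwich[OF _ _ tendsto_const LIMSEQ_inverse_real_of_nat])
        have bound: "norm (R N z - g z) \<le> inverse (real (Suc N))" if "z \<in> E" for N z using R that by blast
        show "\<forall>\<^sub>F N in sequentially. (SUP z\<in>E. norm (R N z - g z)) \<le> inverse (real (Suc N))"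
          using \<open>E \<noteq> {}\<close> bound by (intro always_eventually allI cSUP_least)
        show "\<forall>\<^sub>F N in sequentially. 0 \<le> (SUP z\<in>E. norm (R N z - g z))"
        proof (intro always_eventually allI)
          fix N
          obtain z where z: "z \<in> E" using \<open>E \<noteq> {}\<close> by blast
          have "bdd_above ((\<lambda>z. norm (R N z - g z)) ` E)" using bound by (rule bdd_aboveI2)
          then show "0 \<le> (SUP z\<in>E. norm (R N z - g z))" using z by (intro cSUP_upper2) auto
        qed
      qed
    qed
  next
    fix Q :: "nat \<Rightarrow> complex \<Rightarrow> complex" and f
    assume Q: "\<forall>N. analytic_polynomial (Q N)" and f: "f \<in> H2"
      and lp: "(\<lambda>N. lp_dist_powr p (fourier_coeff (Q N)) (fourier_coeff f)) \<longlonglongrightarrow> 0"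
      and sup: "(\<lambda>N. SUP z\<in>E. norm (Q N z)) \<longlonglongrightarrow> 0"
    have "\<forall>N. \<exists>q :: complex poly. (\<forall>z\<in>circle. Q N z = poly q z) \<and> (\<forall>n. fourier_coeff (Q N) (int n) = coeff q n)"
    proof
      fix N
      obtain q :: "complex poly" where "\<And>z. z \<in> circle \<Longrightarrow> Q N z = poly q z" "\<And>n. fourier_coeff (Q N) (int n) = coeff q n"
        using analytic_polynomial_poly[of "Q N"] Q by auto
      then show "\<exists>q :: complex poly. (\<forall>z\<in>circle. Q N z = poly q z) \<and> (\<forall>n. fourier_coeff (Q N) (int n) = coeff q n)"
        by (intro exI[of _ q]) simp
    qed
    then obtain q :: "nat \<Rightarrow> complex poly" where q_all: "\<forall>N. (\<forall>z\<in>circle. Q N z = poly (q N) z) \<and> (\<forall>n. fourier_coeff (Q N) (int n) = coeff (q N) n)"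
      unfolding choice_iff by (elim exE)
    note q = spec[OF q_all]
    define C where "C = 1 + (LINT z|circle_measure. norm (f z))"
    have "0 \<le> (LINT z|circle_measure. norm (f z))" by simp
    then have C: "1 \<le> C" by (simp add: C_def)
    \<comment> \<open>Uniform convergence of the coefficients both bounds them and identifies their limits.\<close>
    have close: "\<forall>\<^sub>F N in sequentially. \<forall>n. norm (fourier_coeff (Q N) n - fourier_coeff f n) < e" if "e > 0" for e
    proof -
      have "\<forall>\<^sub>F N in sequentially. lp_dist_powr p (fourier_coeff (Q N)) (fourier_coeff f) < ennreal (e powr p)"
        using order_tendstoD(2)[OF lp, of "ennreal (e powr p)"] that by simp
      then show ?thesis
        by eventually_elim (use norm_diff_less_of_lp_dist_powr_less assms(1) that in force)
    qed
    have lim: "(\<lambda>N. coeff (q N) n) \<longlonglongrightarrow> 0" for n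
    proof (rule coefficients_tendsto_0[OF stages C])
      show "\<forall>\<^sub>F N in sequentially. \<forall>n. norm (coeff (q N) n) \<le> C"
        using close[OF zero_less_one]
      proof eventually_elim
        case (elim N)
        show ?case
        proof
          fix n
          have "norm (coeff (q N) n) = norm (fourier_coeff (Q N) (int n))" using q[of N] by simp
          also have "\<dots> \<le> norm (fourier_coeff (Q N) (int n) - fourier_coeff f (int n)) + norm (fourier_coeff f (int n))"
            using norm_triangle_ineq[of "fourier_coeff (Q N) (int n) - fourier_coeff f (int n)" "fourier_coeff f (int n)"] by simp
          also have "\<dots> \<le> C" 
            using elim[rule_format, of "int n"] norm_fourier_coeff_le[of f "int n"] by (simp add: C_def)
          finally show "norm (coeff (q N) n) \<le> C" .
        qed
      qed
      fix \<eta> :: real assume eta: "\<eta> > 0"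
      show "\<forall>\<^sub>F N in sequentially. \<forall>z\<in>E. norm (poly (q N) z) \<le> \<eta>"
        using order_tendstoD(2)[OF sup eta]
      proof eventually_elim
        case (elim N)
        show ?case
        proof
          fix z assume z: "z \<in> E"
          have Q_eq: "Q N z = poly (q N) z" if "z \<in> E" for z using q[of N] that Esub by blast
          have "continuous_on E (poly (q N))" by (intro continuous_intros)
          then have "bdd_above ((\<lambda>z. norm (poly (q N) z)) ` E)" by (rule bdd_above_norm_image[OF E])
          then have "bdd_above ((\<lambda>z. norm (Q N z)) ` E)" by (simp add: Q_eq cong: image_cong)
          then have "norm (Q N z) \<le> (SUP z\<in>E. norm (Q N z))" using z by (intro cSUP_upper)
          then show "norm (poly (q N) z) \<le> \<eta>" using elim Q_eq[OF z] by simp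
        qed
      qed
    qed
    have nonneg: "fourier_coeff f (int n) = 0" for n
    proof -
      have "(\<lambda>N. coeff (q N) n) \<longlonglongrightarrow> fourier_coeff f (int n)"
      proof (rule tendstoI)
        fix e :: real assume "e > 0"
        from close[OF this] show "\<forall>\<^sub>F N in sequentially. dist (coeff (q N) n) (fourier_coeff f (int n)) < e"
        proof eventually_elim
          case (elim N)
          have "coeff (q N) n = fourier_coeff (Q N) (int n)" using q[of N] by simp
          then show ?case using elim by (simp add: dist_norm)
        qed
      qed
      then show ?thesis using LIMSEQ_unique lim by blast
    qed
    have "fourier_coeff f n = 0" for n
    proof (cases "n < 0")
      case True
      then show ?thesis using f by (simp add: H2_def)
    next
      case False
      then show ?thesis using nonneg[of "nat n"] by simp
    qed
    then show "AE z in circle_measure. f z = 0"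
      by (rule fourier_coeff_unique[OF integrable_H2[OF f]])
  qed
qed

end
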